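(* Let $\nu$ be a real number with $0<\nu<1$. Then the following three series converge, with sums as given: \[ \text{(i)}\quad \sum_{k=2}^{\infty}\log\left(\frac{k-1}{k+1}\right)\sin(2k\nu\pi)=\sin(2\nu\pi)\bigl(\log(4\pi)-\psi(1)+\psi(\nu)\bigr)+\pi\cos^{2}(\nu\pi); \] \[ \text{(ii)}\quad \sum_{k=2}^{\infty}\log\left(\frac{2k-1}{2k+1}\right)\sin(2k\nu\pi)=\frac{1}{2}\sin(\nu\pi)\left(\psi\left(\frac{\nu}{2}\right)-\psi\left(\frac{\nu+1}{2}\right)\right)+\frac{\pi}{2}+\log(3)\sin(2\nu\pi); \] \[ \text{(iii)}\quad \sum_{k=2}^{\infty}\log\left(\frac{4(k^{2}-1)}{4k^{2}-1}\right)\cos(2k\nu\pi)=\frac{1}{2}\cos(\nu\pi)\left(\psi\left(\frac{\nu+1}{2}\right)-\psi\left(\frac{\nu}{2}\right)-4\log(2)\cos(\nu\pi)\right)-\frac{\pi}{2}\sin(2\nu\pi)+\cos(2\nu\pi)\left(\log\left(\frac{3\pi}{2}\right)-\psi(1)+\psi(\nu)\right). \]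
   Context: $\psi(z)=\Gamma'(z)/\Gamma(z)$ denotes the digamma function and $\log$ the real natural logarithm. Infinite series $\sum_{k=2}^{\infty}a_k$ are understood as limits of partial sums $\lim_{N\to\infty}\sum_{k=2}^{N}a_k$ (convergence need not be absolute). *)

theory Defs
  imports "HOL-Analysis.Analysis"
begin

text \<open>
  The library defines \<^term>\<open>Digamma\<close> by a series; on the positive reals it is the
  logarithmic derivative of the Gamma function.
\<close>

lemma Digamma_eq_deriv_Gamma_divide:
  fixes x :: real
  assumes "x > 0"
  shows "Digamma x = deriv Gamma x / Gamma x"
proof -
  have "x \<notin> \<int>\<^sub>\<le>\<^sub>0"
    using assms by (auto elim!: nonpos_Ints_cases)
  then have "(Gamma has_field_derivative (Gamma x * Digamma x)) (at x)"
    by (rule has_field_derivative_Gamma)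
  then have "deriv Gamma x = Gamma x * Digamma x"
    by (rule DERIV_imp_deriv)
  moreover have "Gamma x \<noteq> 0"
    using Gamma_real_pos[OF assms] by simp
  ultimately show ?thesis by simp
qed

end

theory Submission
  imports Defs "HOL-Real_Asymp.Real_Asymp"
begin

text \<open>
  Write each logarithm as an integral of partial fractions,
  \<open>ln ((k + b) / (k - b)) = \<integral>\<^sub>0\<^sup>b 2k / (k\<^sup>2 - x\<^sup>2) dx\<close> for the sine series and with
  \<open>2x / (k\<^sup>2 - x\<^sup>2)\<close> in place of \<open>2k / (k\<^sup>2 - x\<^sup>2)\<close> for the cosine series. Summation by parts bounds the partial
  sums uniformly in \<open>x\<close>, so dominated convergence moves the sum under the integral, and the sums
  over \<open>k\<close> are the Fourier series of \<open>sin (x (\<pi> - \<alpha>))\<close> and \<open>cos (x (\<pi> - \<alpha>))\<close> in \<open>\<alpha> = 2 \<pi> \<nu>\<close>.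
  After the reflection \<open>x = 1 - y\<close> on \<open>[1/2, 1]\<close>, everything is expressed by the integrals over
  \<open>[0, 1/2]\<close> of \<open>\<pi> sin (m \<pi> y) / sin (\<pi> y)\<close> and \<open>\<pi> (1 - cos (m \<pi> y)) / sin (\<pi> y)\<close>, \<open>m = 2 \<nu> - 1\<close>.
  These satisfy first-order recursions under \<open>\<nu> \<mapsto> \<nu> + 1\<close> matching those of the digamma function, so
  their differences from the claimed closed forms are 1-periodic in \<open>\<nu>\<close>; by the Riemann-Lebesgue
  lemma these differences do not depend on \<open>\<nu>\<close>, and they vanish at \<open>\<nu> = 1\<close>.
\<close>

section \<open>The Riemann-Lebesgue lemma and Fourier series\<close>

text \<open>The phase \<open>\<theta> n\<close> may vary with \<open>n\<close>, so one statement
  covers sines, cosines and kernels centred at a point. Uniform polynomial approximation reduces the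
  claim to a smooth factor, where one integration by parts gains a factor
  \<open>1 / l n\<close>.\<close>

lemma riemann_lebesgue:
  fixes f :: "real \<Rightarrow> real" and l \<theta> :: "nat \<Rightarrow> real"
  assumes ab: "a \<le> b" and f: "continuous_on {a..b} f" and l: "filterlim l at_top sequentially"
  shows "(\<lambda>n. integral {a..b} (\<lambda>u. f u * sin (l n * u + \<theta> n))) \<longlonglongrightarrow> 0"
proof (rule LIMSEQ_I)
  fix e :: real assume e: "0 < e"
  \<comment> \<open>The summand \<open>1\<close> keeps the denominator positive when
    \<open>a = b\<close> and makes \<open>d * (b - a) < e / 2\<close> strict.\<close>
  define d where "d = e / (2 * (b - a + 1))"
  have d: "0 < d" using ab e by (simp add: d_def)
  obtain p where p: "real_polynomial_function p" and fp: "\<And>x. x \<in> {a..b} \<Longrightarrow> \<bar>f x - p x\<bar> < d"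
    using Stone_Weierstrass_real_polynomial_function[of "{a..b}" f d] f d by auto
  obtain p' where p': "real_polynomial_function p'" and dp: "\<And>x. (p has_real_derivative p' x) (at x)"
    using has_real_derivative_polynomial_function[OF p] by auto
  have cont: "continuous_on {a..b} p" "continuous_on {a..b} p'"
    using p p' continuous_real_polymonial_function by (auto intro!: continuous_at_imp_continuous_on)
  obtain M where M: "\<And>x. x \<in> {a..b} \<Longrightarrow> \<bar>p x\<bar> \<le> M"
    using compact_imp_bounded[OF compact_continuous_image[OF cont(1)]] unfolding bounded_iff real_norm_def by blast
  obtain M' where M': "\<And>x. x \<in> {a..b} \<Longrightarrow> \<bar>p' x\<bar> \<le> M'"
    using compact_imp_bounded[OF compact_continuous_image[OF cont(2)]] unfolding bounded_iff real_norm_def by blast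
  \<comment> \<open>Two boundary terms of size at most \<open>M\<close>, plus the integral of
    \<open>p'\<close> against a cosine. The constant depends on neither the frequency nor the
    phase.\<close>
  define K where "K = 2 * M + M' * (b - a)"
  have K: "\<bar>integral {a..b} (\<lambda>u. p u * sin (c * u + t))\<bar> \<le> K / c" if c: "c > 0" for c t
  proof -
    define P where "P = (\<lambda>u. p u * cos (c * u + t))"
    have "((\<lambda>u. p' u * cos (c * u + t) - c * (p u * sin (c * u + t))) has_integral (P b - P a)) {a..b}"
      unfolding P_def has_real_derivative_iff_has_vector_derivative[symmetric]
      by (intro fundamental_theorem_of_calculus ab)
         (auto simp: has_real_derivative_iff_has_vector_derivative[symmetric]
            intro!: derivative_eq_intros DERIV_subset[OF dp])
    moreover have int: "(\<lambda>u. p' u * cos (c * u + t)) integrable_on {a..b}"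
      by (intro integrable_continuous_interval continuous_intros cont)
    ultimately have "((\<lambda>u. p' u * cos (c * u + t) - (p' u * cos (c * u + t) - c * (p u * sin (c * u + t))))
        has_integral (integral {a..b} (\<lambda>u. p' u * cos (c * u + t)) - (P b - P a))) {a..b}"
      using has_integral_diff[OF integrable_integral] by blast
    then have "((\<lambda>u. 1 / c * (c * (p u * sin (c * u + t)))) has_integral
        1 / c * (integral {a..b} (\<lambda>u. p' u * cos (c * u + t)) - (P b - P a))) {a..b}"
      by (intro has_integral_mult_right) simp
    then have "integral {a..b} (\<lambda>u. p u * sin (c * u + t))
       = (integral {a..b} (\<lambda>u. p' u * cos (c * u + t)) - (P b - P a)) / c"
      using c by (auto dest: integral_unique)
    moreover have "\<bar>integral {a..b} (\<lambda>u. p' u * cos (c * u + t))\<bar> \<le> M' * (b - a)"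
    proof -
      have "norm (p' x * cos (c * x + t)) \<le> M'" if "x \<in> {a..b}" for x
        using mult_mono[OF M'[OF that] abs_cos_le_one[of "c * x + t"]] M'[OF that]
        by (simp add: abs_mult)
      then show ?thesis
        using integral_bound[OF ab, of "\<lambda>u. p' u * cos (c * u + t)" M']
        by (simp add: cont continuous_intros)
    qed
    moreover have "\<bar>P x\<bar> \<le> M" if "x \<in> {a..b}" for x
      using mult_mono[OF M[OF that] abs_cos_le_one[of "c * x + t"]] M[OF that]
      by (simp add: abs_mult P_def)
    from this[of a] this[of b] ab have "\<bar>P a\<bar> \<le> M" "\<bar>P b\<bar> \<le> M" by auto
    ultimately show ?thesis
      using c by (auto simp: K_def abs_divide intro!: divide_right_mono)
  qed
  have "eventually (\<lambda>n. l n > max 0 (2 * K / e)) sequentially"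
    using l unfolding filterlim_at_top_dense by blast
  then obtain N where N: "\<And>n. n \<ge> N \<Longrightarrow> l n > max 0 (2 * K / e)"
    by (auto simp: eventually_sequentially)
  have "norm (integral {a..b} (\<lambda>u. f u * sin (l n * u + \<theta> n)) - 0) < e" if n: "n \<ge> N" for n
  proof -
    let ?s = "\<lambda>u. sin (l n * u + \<theta> n)"
    have "integral {a..b} (\<lambda>u. f u * ?s u)
        = integral {a..b} (\<lambda>u. (f u - p u) * ?s u) + integral {a..b} (\<lambda>u. p u * ?s u)"
      by (subst integral_add[symmetric])
         (auto intro!: integrable_continuous_interval continuous_intros f cont simp: algebra_simps)
    moreover have "\<bar>integral {a..b} (\<lambda>u. (f u - p u) * ?s u)\<bar> \<le> d * (b - a)"
    proof -
      have "norm ((f x - p x) * ?s x) \<le> d" if "x \<in> {a..b}" for x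
        using mult_mono[OF less_imp_le[OF fp[OF that]] abs_sin_le_one[of "l n * x + \<theta> n"]] d
        by (simp add: abs_mult)
      then show ?thesis
        using integral_bound[OF ab, of "\<lambda>u. (f u - p u) * ?s u" d]
        by (simp add: f cont continuous_intros)
    qed
    moreover have "d * (b - a) < e / 2"
      using ab e by (simp add: d_def field_simps)
    moreover have "\<bar>integral {a..b} (\<lambda>u. p u * ?s u)\<bar> \<le> K / l n"
      using K N[OF n] by simp
    moreover have "K / l n < e / 2"
      using N[OF n] e by (simp add: field_simps)
    ultimately show ?thesis unfolding diff_0_right real_norm_def by linarith
  qed
  then show "\<exists>no. \<forall>n\<ge>no. norm (integral {a..b} (\<lambda>u. f u * sin (l n * u + \<theta> n)) - 0) < e"
    by blast
qed

text \<open>The value \<open>c\<close> at \<open>0\<close> removes the singularity; bare division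
  would give \<open>0\<close> there. The result is continuous on (-pi, pi), as the Riemann-Lebesgue
  lemma requires of the amplitude.\<close>

definition sin_ratio :: "real \<Rightarrow> real \<Rightarrow> real" where
  "sin_ratio c v = (if v = 0 then c else sin (c * v) / sin v)"

lemma isCont_sin_ratio:
  assumes "\<bar>v\<bar> < pi"
  shows "isCont (sin_ratio c) v"
proof (cases "v = 0")
  case True
  have *: "((\<lambda>v. sin (k * v) / v) \<longlongrightarrow> k) (at 0)" for k :: real
  proof -
    have "((\<lambda>v. sin (k * v)) has_real_derivative k) (at 0)"
      by (auto intro!: derivative_eq_intros)
    then show ?thesis by (simp add: has_field_derivative_iff)
  qed
  have "((\<lambda>v. (sin (c * v) / v) / (sin (1 * v) / v)) \<longlongrightarrow> c) (at 0)"
    using tendsto_divide[OF *[of c] *[of 1]] by simp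
  then have "(sin_ratio c \<longlongrightarrow> c) (at 0)"
    by (rule Lim_transform_eventually)
       (auto simp: sin_ratio_def eventually_at_filter intro!: always_eventually)
  then show ?thesis by (simp add: True isCont_def) (simp add: sin_ratio_def)
next
  case False
  have "sin v \<noteq> 0"
    using assms False sin_eq_0_pi[of v] by (auto simp: abs_less_iff)
  have ev: "eventually (\<lambda>x. x \<noteq> 0) (nhds v)"
    using False by (intro t1_space_nhds) auto
  have "isCont (\<lambda>v. sin (c * v) / sin v) v"
    using \<open>sin v \<noteq> 0\<close> by (intro continuous_intros)
  moreover have "eventually (\<lambda>x. sin (c * x) / sin x = sin_ratio c x) (nhds v)"
    using ev by eventually_elim (simp add: sin_ratio_def)
  ultimately show ?thesis using isCont_cong by metis
qed

lemma continuous_on_sin_ratio: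
  assumes "continuous_on A g" "\<And>x. x \<in> A \<Longrightarrow> \<bar>g x\<bar> < pi"
  shows "continuous_on A (\<lambda>x. sin_ratio c (g x))"
proof -
  have "continuous_on {-pi<..<pi} (sin_ratio c)"
    by (intro continuous_at_imp_continuous_on ballI isCont_sin_ratio) auto
  then show ?thesis
    by (rule continuous_on_compose2[OF _ assms(1)]) (use assms(2) in \<open>force simp: abs_less_iff\<close>)
qed

lemma sin_ratio_mult_sin: "\<bar>v\<bar> < pi \<Longrightarrow> sin_ratio c v * sin v = sin (c * v)"
  using sin_eq_0_pi[of v] by (auto simp: sin_ratio_def abs_less_iff)

section \<open>The Dirichlet kernel and pointwise convergence of a Fourier series\<close>

lemma dirichlet_kernel:
  fixes v :: real
  shows "(1 + 2 * (\<Sum>k=1..N. cos (real k * (2 * v)))) * sin v = sin ((2 * real N + 1) * v)"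
proof (induction N)
  case (Suc N)
  \<comment> \<open>The product formula makes the sum telescope.\<close>
  have "2 * cos (real (Suc N) * (2 * v)) * sin v
      = sin (real (Suc N) * (2 * v) + v) - sin (real (Suc N) * (2 * v) - v)"
    by (simp add: sin_add sin_diff)
  also have "real (Suc N) * (2 * v) + v = (2 * real (Suc N) + 1) * v"
    by (simp add: algebra_simps)
  also have "real (Suc N) * (2 * v) - v = (2 * real N + 1) * v"
    by (simp add: algebra_simps)
  finally show ?case using Suc by (simp add: algebra_simps)
qed simp

lemma has_integral_cos_affine:
  fixes c t a b :: real
  assumes "c \<noteq> 0" "a \<le> b"
  shows "((\<lambda>u. cos (c * u + t)) has_integral (sin (c * b + t) - sin (c * a + t)) / c) {a..b}"
proof -
  have "((\<lambda>u. cos (c * u + t)) has_integral (sin (c * b + t) / c - sin (c * a + t) / c)) {a..b}"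
    using assms
    by (intro fundamental_theorem_of_calculus)
       (auto simp: has_real_derivative_iff_has_vector_derivative[symmetric]
          intro!: derivative_eq_intros)
  then show ?thesis by (simp add: diff_divide_distrib)
qed

text \<open>The product splits into cosines of frequencies \<open>k - x\<close> and
  \<open>k + x\<close>, both nonzero by assumption. Over a full period the \<open>k\<close> part of
  the endpoint shift disappears, leaving the common factor \<open>sin (pi * x)\<close>. The phase
  \<open>\<delta>\<close> serves to extract a sine series and a cosine series from one
  computation.\<close>

lemma has_integral_cos_mult_cos:
  fixes x \<delta> \<alpha> :: real and k :: nat
  assumes "real k \<noteq> x" "real k \<noteq> - x"
  shows "((\<lambda>u. cos (x * (pi - u) + \<delta>) * (2 * cos (real k * (u - \<alpha>)))) has_integral
     2 * sin (pi * x) * (cos (\<delta> + real k * \<alpha>) / (real k + x) - cos (\<delta> - real k * \<alpha>) / (real k - x)))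
     {0..2 * pi}"
proof -
  \<comment> \<open>The phases are chosen so that, up to the sign of the argument, the two cosines
    are those of the sum and the difference of \<open>x * (pi - u) + \<delta>\<close> and
    \<open>k * (u - \<alpha>)\<close>.\<close>
  define s where "s = x * pi + \<delta> - k * \<alpha>"
  define t where "t = - (x * pi + \<delta> + k * \<alpha>)"
  have int: "((\<lambda>u. cos ((k - x) * u + s) + cos ((k + x) * u + t)) has_integral
     (sin ((k - x) * (2 * pi) + s) - sin ((k - x) * 0 + s)) / (k - x)
     + (sin ((k + x) * (2 * pi) + t) - sin ((k + x) * 0 + t)) / (k + x)) {0..2*pi}"
    using assms by (intro has_integral_add has_integral_cos_affine) auto
  have integrand: "cos ((k - x) * u + s) + cos ((k + x) * u + t)
      = cos (x * (pi - u) + \<delta>) * (2 * cos (real k * (u - \<alpha>)))" for u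
  proof -
    have "(k - x) * u + s = (x * (pi - u) + \<delta>) + real k * (u - \<alpha>)"
      by (simp add: s_def algebra_simps)
    moreover have "(k + x) * u + t = - ((x * (pi - u) + \<delta>) - real k * (u - \<alpha>))"
      by (simp add: t_def algebra_simps)
    ultimately show ?thesis by (simp only: cos_minus) (simp add: cos_add cos_diff)
  qed
  have lower: "sin ((k - x) * (2 * pi) + s) - sin ((k - x) * 0 + s)
      = - (2 * sin (pi * x) * cos (\<delta> - k * \<alpha>))"
  proof -
    have "(k - x) * (2 * pi) + s = ((\<delta> - k * \<alpha>) - pi * x) + 2 * pi * k"
      by (simp add: s_def algebra_simps)
    then have "sin ((k - x) * (2 * pi) + s) = sin ((\<delta> - k * \<alpha>) - pi * x)"
      using sin.plus_of_nat[of "(\<delta> - k * \<alpha>) - pi * x" k] by (simp add: mult_ac)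
    moreover have "s = (\<delta> - k * \<alpha>) + pi * x" by (simp add: s_def algebra_simps)
    ultimately have "sin ((k - x) * (2 * pi) + s) - sin ((k - x) * 0 + s)
        = sin ((\<delta> - k * \<alpha>) - pi * x) - sin ((\<delta> - k * \<alpha>) + pi * x)"
      by simp
    then show ?thesis by (simp only: sin_add[of _ "pi * x"] sin_diff[of _ "pi * x"]) simp
  qed
  have upper: "sin ((k + x) * (2 * pi) + t) - sin ((k + x) * 0 + t)
      = 2 * sin (pi * x) * cos (\<delta> + k * \<alpha>)"
  proof -
    have "(k + x) * (2 * pi) + t = (pi * x - (\<delta> + k * \<alpha>)) + 2 * pi * k"
      by (simp add: t_def algebra_simps)
    then have "sin ((k + x) * (2 * pi) + t) = sin (pi * x - (\<delta> + k * \<alpha>))"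
      using sin.plus_of_nat[of "pi * x - (\<delta> + k * \<alpha>)" k] by (simp add: mult_ac)
    moreover have "sin t = - sin (pi * x + (\<delta> + k * \<alpha>))"
      unfolding sin_minus[symmetric] by (simp add: t_def algebra_simps)
    ultimately have "sin ((k + x) * (2 * pi) + t) - sin ((k + x) * 0 + t)
        = sin (pi * x - (\<delta> + k * \<alpha>)) + sin (pi * x + (\<delta> + k * \<alpha>))"
      by simp
    then show ?thesis by (simp only: sin_add[of "pi * x"] sin_diff[of "pi * x"])
  qed
  show ?thesis
    by (rule has_integral_eq_rhs[OF int[unfolded integrand lower upper]]) (simp add: algebra_simps)
qed

text \<open>This is the Fourier expansion of \<open>cos (x * (pi - u) + \<delta>)\<close> on
  [0, 2 pi] at the interior point \<open>u = \<alpha>\<close>, with the constant term moved to the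
  right. The error is the integral of \<open>f u - f \<alpha>\<close> against the Dirichlet kernel;
  dividing by the sine in the kernel leaves a continuous amplitude, so Riemann-Lebesgue
  finishes.\<close>

lemma fourier_series_cos:
  fixes x \<delta> \<alpha> :: real
  assumes x: "0 < x" "x < 1" and \<alpha>: "0 < \<alpha>" "\<alpha> < 2 * pi"
  shows "(\<lambda>N. \<Sum>k=1..N. 2 * sin (pi * x) *
            (cos (\<delta> + real k * \<alpha>) / (real k + x) - cos (\<delta> - real k * \<alpha>) / (real k - x)))
     \<longlonglongrightarrow> 2 * pi * cos (x * (pi - \<alpha>) + \<delta>) - 2 * cos \<delta> * sin (pi * x) / x"
proof -
  define f where "f = (\<lambda>u. cos (x * (pi - u) + \<delta>))"
  define D where "D = (\<lambda>N u. 1 + 2 * (\<Sum>k=1..N. cos (real k * (u - \<alpha>))))"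
  define c where "c = (\<lambda>k::nat. 2 * sin (pi * x) *
            (cos (\<delta> + real k * \<alpha>) / (real k + x) - cos (\<delta> - real k * \<alpha>) / (real k - x)))"
  \<comment> \<open>The quotient of \<open>f u - f \<alpha>\<close> by
    \<open>sin ((u - \<alpha>) / 2)\<close>, written by the sum-to-product formula so as to be
    continuous at \<open>u = \<alpha>\<close> as well.\<close>
  define \<phi> where "\<phi> = (\<lambda>u. 2 * sin (x * (pi - (u + \<alpha>) / 2) + \<delta>) * sin_ratio x ((u - \<alpha>) / 2))"
  have small: "\<bar>(u - \<alpha>) / 2\<bar> < pi" if "u \<in> {0..2 * pi}" for u
    using that \<alpha> by (auto simp: abs_less_iff)
  have 1: "((\<lambda>u. f u * D N u) has_integral (2 * cos \<delta> * sin (pi * x) / x + (\<Sum>k=1..N. c k))) {0..2*pi}" for N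
  proof -
    \<comment> \<open>The case \<open>k = 0\<close> is halved because the constant term of
      \<open>D N\<close> is 1 and not 2.\<close>
    have "((\<lambda>u. cos (x * (pi - u) + \<delta>) * (2 * cos (real 0 * (u - \<alpha>)))) has_integral
        2 * sin (pi * x) * (cos (\<delta> + real 0 * \<alpha>) / (real 0 + x) - cos (\<delta> - real 0 * \<alpha>) / (real 0 - x)))
        {0..2 * pi}"
      by (rule has_integral_cos_mult_cos) (use x in auto)
    from has_integral_mult_right[OF this, of "1/2"]
    have "(f has_integral 2 * cos \<delta> * sin (pi * x) / x) {0..2*pi}"
      by (simp add: f_def mult_ac)
    moreover have "((\<lambda>u. f u * (2 * cos (real k * (u - \<alpha>)))) has_integral c k) {0..2*pi}"
      if "k \<in> {1..N}" for k
      unfolding f_def c_def by (rule has_integral_cos_mult_cos) (use x that in auto)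
    ultimately have "((\<lambda>u. f u + (\<Sum>k=1..N. f u * (2 * cos (real k * (u - \<alpha>))))) has_integral
        (2 * cos \<delta> * sin (pi * x) / x + (\<Sum>k=1..N. c k))) {0..2*pi}"
      by (intro has_integral_add has_integral_sum) auto
    then show ?thesis
      by (simp add: D_def algebra_simps sum_distrib_left)
  qed
  \<comment> \<open>The kernel has total mass 2 pi, so its integral against the constant
    \<open>f \<alpha>\<close> is the expected limit.\<close>
  have 2: "((\<lambda>u. f \<alpha> * D N u) has_integral f \<alpha> * (2 * pi)) {0..2*pi}" for N
  proof -
    have "((\<lambda>u. cos (real k * (u - \<alpha>))) has_integral 0) {0..2*pi}" if "k \<in> {1..N}" for k
    proof -
      have "sin (real k * (2 * pi) - real k * \<alpha>) = sin (- (real k * \<alpha>))"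
        using sin.plus_of_nat[of "- (real k * \<alpha>)" k] by (simp add: algebra_simps)
      then show ?thesis
        using has_integral_cos_affine[of "real k" 0 "2 * pi" "- (real k * \<alpha>)"] that
        by (simp add: algebra_simps)
    qed
    then have "((\<lambda>u. \<Sum>k=1..N. cos (real k * (u - \<alpha>))) has_integral (\<Sum>k=1..N. 0)) {0..2*pi}"
      by (intro has_integral_sum) auto
    from has_integral_add[OF has_integral_const_real[of 1 0 "2 * pi"] has_integral_mult_right[OF this, of 2]]
    show ?thesis
      unfolding D_def by (intro has_integral_mult_right) simp
  qed
  have 3: "(f u - f \<alpha>) * D N u = \<phi> u * sin ((real N + 1/2) * u + (- (real N + 1/2) * \<alpha>))"
    if "u \<in> {0..2*pi}" for N u
  proof -
    define v where "v = (u - \<alpha>) / 2"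
    have e1: "f u - f \<alpha> = 2 * sin (x * (pi - (u + \<alpha>) / 2) + \<delta>) * sin (x * v)"
      unfolding f_def cos_diff_cos by (simp add: v_def field_simps)
    have e2: "sin (x * v) = sin_ratio x v * sin v"
      using sin_ratio_mult_sin small[OF that] by (simp add: v_def)
    have e3: "D N u * sin v = sin ((2 * real N + 1) * v)"
    proof -
      have "2 * v = u - \<alpha>" by (simp add: v_def)
      then show ?thesis using dirichlet_kernel[where N=N and v=v] by (simp only: D_def)
    qed
    have e4: "(2 * real N + 1) * v = (real N + 1/2) * u + (- (real N + 1/2) * \<alpha>)"
      by (simp add: v_def field_simps)
    have "(f u - f \<alpha>) * D N u
        = 2 * sin (x * (pi - (u + \<alpha>) / 2) + \<delta>) * sin_ratio x v * (D N u * sin v)"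
      unfolding e1 e2 by simp
    then show ?thesis
      unfolding e3 e4 by (simp only: \<phi>_def v_def)
  qed
  have "integral {0..2*pi} (\<lambda>u. \<phi> u * sin ((real N + 1/2) * u + (- (real N + 1/2) * \<alpha>)))
      = 2 * cos \<delta> * sin (pi * x) / x + (\<Sum>k=1..N. c k) - f \<alpha> * (2 * pi)" for N
    using has_integral_diff[OF 1 2, of N N]
    by (intro integral_unique has_integral_eq[OF 3]) (auto simp: algebra_simps)
  moreover have "(\<lambda>N. integral {0..2*pi} (\<lambda>u. \<phi> u * sin ((real N + 1/2) * u + (- (real N + 1/2) * \<alpha>)))) \<longlonglongrightarrow> 0"
  proof (rule riemann_lebesgue)
    show "continuous_on {0..2*pi} \<phi>"
      unfolding \<phi>_def by (intro continuous_intros continuous_on_sin_ratio small) simp_all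
    show "filterlim (\<lambda>n. real n + 1/2) at_top sequentially"
      by (intro filterlim_tendsto_add_at_top_iff[THEN iffD2] filterlim_real_sequentially
          filterlim_at_top_mono[OF filterlim_real_sequentially]) auto
  qed auto
  ultimately have "(\<lambda>N. 2 * cos \<delta> * sin (pi * x) / x + (\<Sum>k=1..N. c k) - f \<alpha> * (2 * pi)) \<longlonglongrightarrow> 0"
    by simp
  from tendsto_add[OF this tendsto_const[of "f \<alpha> * (2 * pi) - 2 * cos \<delta> * sin (pi * x) / x"]]
  show ?thesis by (simp add: c_def f_def algebra_simps)
qed

section \<open>The sine and cosine series with partial fraction coefficients\<close>

lemma sum_sin_partial_fractions:
  fixes x \<alpha> :: real
  assumes x: "0 < x" "x < 1" and \<alpha>: "0 < \<alpha>" "\<alpha> < 2 * pi"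
  shows "(\<lambda>N. \<Sum>k=1..N. 2 * real k / ((real k)\<^sup>2 - x\<^sup>2) * sin (real k * \<alpha>))
     \<longlonglongrightarrow> pi * sin (x * (pi - \<alpha>)) / sin (pi * x)"
proof -
  have s: "sin (pi * x) > 0" using x by (intro sin_gt_zero) auto
  \<comment> \<open>With \<open>\<delta> = - (pi / 2)\<close> the two cosines become sines of
    opposite sign, so the fractions add up to \<open>2 * k / (k\<^sup>2 - x\<^sup>2)\<close>; the
    constant term vanishes since \<open>cos \<delta> = 0\<close>.\<close>
  have eq: "2 * sin (pi * x) * (cos (- (pi/2) + real k * \<alpha>) / (real k + x) - cos (- (pi/2) - real k * \<alpha>) / (real k - x)) / (2 * sin (pi * x))
    = 2 * real k / ((real k)\<^sup>2 - x\<^sup>2) * sin (real k * \<alpha>)" if "k \<in> {1..N}" for k N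
  proof -
    have "real k \<noteq> x" "real k + x \<noteq> 0" "(real k)\<^sup>2 - x\<^sup>2 = (real k + x) * (real k - x)"
      using that x by (auto simp: power2_eq_square algebra_simps)
    moreover have "cos (- (pi/2) + t) = sin t" "cos (- (pi/2) - t) = - sin t" for t
      by (simp_all add: cos_add cos_diff)
    ultimately show ?thesis using s
      by (simp only: , simp add: divide_simps) (simp add: algebra_simps)
  qed
  have "2 * sin (pi * x) \<noteq> 0" using s by simp
  from tendsto_divide[OF fourier_series_cos[OF x \<alpha>, of "- (pi / 2)"] tendsto_const this]
  have "(\<lambda>N. \<Sum>k=1..N. 2 * real k / ((real k)\<^sup>2 - x\<^sup>2) * sin (real k * \<alpha>)) \<longlonglongrightarrow>
    (2 * pi * cos (x * (pi - \<alpha>) + - (pi / 2)) - 2 * cos (- (pi / 2)) * sin (pi * x) / x) / (2 * sin (pi * x))"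
    by (simp only: sum_divide_distrib eq cong: sum.cong)
  then show ?thesis by (simp add: cos_diff)
qed

lemma sum_cos_partial_fractions:
  fixes x \<alpha> :: real
  assumes x: "0 < x" "x < 1" and \<alpha>: "0 < \<alpha>" "\<alpha> < 2 * pi"
  shows "(\<lambda>N. \<Sum>k=1..N. 2 * x / ((real k)\<^sup>2 - x\<^sup>2) * cos (real k * \<alpha>))
     \<longlonglongrightarrow> 1 / x - pi * cos (x * (pi - \<alpha>)) / sin (pi * x)"
proof -
  have s: "sin (pi * x) > 0" using x by (intro sin_gt_zero) auto
  \<comment> \<open>With \<open>\<delta> = 0\<close> the fractions subtract to
    \<open>- 2 * x / (k\<^sup>2 - x\<^sup>2)\<close>, whence the negative divisor. The constant term
    survives as \<open>1 / x\<close>.\<close>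
  have eq: "2 * sin (pi * x) * (cos (0 + real k * \<alpha>) / (real k + x) - cos (0 - real k * \<alpha>) / (real k - x)) / (- 2 * sin (pi * x))
    = 2 * x / ((real k)\<^sup>2 - x\<^sup>2) * cos (real k * \<alpha>)" if "k \<in> {1..N}" for k N
  proof -
    have "real k \<noteq> x" "real k + x \<noteq> 0" "(real k)\<^sup>2 - x\<^sup>2 = (real k + x) * (real k - x)"
      using that x by (auto simp: power2_eq_square algebra_simps)
    then show ?thesis using s
      by (simp add: divide_simps) (simp add: algebra_simps)
  qed
  have "- 2 * sin (pi * x) \<noteq> 0" using s by simp
  from tendsto_divide[OF fourier_series_cos[OF x \<alpha>, of 0] tendsto_const this]
  have "(\<lambda>N. \<Sum>k=1..N. 2 * x / ((real k)\<^sup>2 - x\<^sup>2) * cos (real k * \<alpha>)) \<longlonglongrightarrow>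
    (2 * pi * cos (x * (pi - \<alpha>) + 0) - 2 * cos 0 * sin (pi * x) / x) / (- 2 * sin (pi * x))"
    by (simp only: sum_divide_distrib eq cong: sum.cong)
  moreover have "(2 * pi * cos (x * (pi - \<alpha>) + 0) - 2 * cos 0 * sin (pi * x) / x) / (- 2 * sin (pi * x))
    = 1 / x - pi * cos (x * (pi - \<alpha>)) / sin (pi * x)"
    using s x by (simp add: field_simps)
  ultimately show ?thesis by metis
qed

section \<open>Integrating a series term by term\<close>

text \<open>Applied pointwise in \<open>x\<close>, this gives a bound independent of the number of
  terms, hence a dominating function for series that need not converge absolutely.\<close>

lemma abel_summation_bound:
  fixes a b :: "nat \<Rightarrow> real"
  assumes bounded: "\<And>n. \<bar>\<Sum>k=m..n. b k\<bar> \<le> B"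
    and decr: "\<And>k. k \<ge> m \<Longrightarrow> a (Suc k) \<le> a k" and nonneg: "\<And>k. k \<ge> m \<Longrightarrow> 0 \<le> a k"
  shows "\<bar>\<Sum>k=m..n. a k * b k\<bar> \<le> a m * B"
proof (cases "m \<le> n")
  case True
  \<comment> \<open>Subtracting the boundary term makes the induction work: each step adds exactly
    \<open>a n - a (Suc n)\<close> times a partial sum of \<open>b\<close>, and these bounds
    telescope.\<close>
  have "\<bar>(\<Sum>k=m..n. a k * b k) - a n * (\<Sum>k=m..n. b k)\<bar> \<le> (a m - a n) * B"
    using True
  proof (induction n rule: dec_induct)
    case (step n)
    have "(\<Sum>k=m..Suc n. a k * b k) - a (Suc n) * (\<Sum>k=m..Suc n. b k)
        = ((\<Sum>k=m..n. a k * b k) - a n * (\<Sum>k=m..n. b k)) + (a n - a (Suc n)) * (\<Sum>k=m..n. b k)"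
      using step.hyps by (simp add: algebra_simps)
    moreover have "\<bar>(a n - a (Suc n)) * (\<Sum>k=m..n. b k)\<bar> \<le> (a n - a (Suc n)) * B"
      using bounded[of n] decr[OF step.hyps(1)] by (auto simp: abs_mult intro!: mult_left_mono)
    ultimately show ?case using step.IH by (simp add: algebra_simps)
  qed simp
  moreover have "\<bar>a n * (\<Sum>k=m..n. b k)\<bar> \<le> a n * B"
    using bounded[of n] nonneg[OF True] by (auto simp: abs_mult intro!: mult_left_mono)
  ultimately show ?thesis by (simp add: algebra_simps)
next
  case False
  then show ?thesis using bounded[of n] nonneg[of m] by simp
qed

text \<open>Multiplication by \<open>2 * sin (\<alpha> / 2)\<close> makes the sum telescope. The
  shift \<open>\<delta> = pi / 2\<close> yields the same bound for cosines.\<close>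

lemma sum_sin_progression_bound:
  fixes \<alpha> \<delta> :: real
  assumes "0 < \<alpha>" "\<alpha> < 2 * pi"
  shows "\<bar>\<Sum>k=m..n. sin (real k * \<alpha> + \<delta>)\<bar> \<le> 1 / sin (\<alpha> / 2)"
proof -
  have s: "sin (\<alpha> / 2) > 0" using assms by (intro sin_gt_zero) auto
  show ?thesis
  proof (cases "m \<le> n")
    case True
    then have "2 * sin (\<alpha> / 2) * (\<Sum>k=m..n. sin (real k * \<alpha> + \<delta>))
       = cos (real m * \<alpha> + \<delta> - \<alpha> / 2) - cos (real n * \<alpha> + \<delta> + \<alpha> / 2)"
    proof (induction n rule: dec_induct)
      case base
      show ?case by (simp add: cos_add[of _ "\<alpha> / 2"] cos_diff[of _ "\<alpha> / 2"])
    next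
      case (step n)
      have "real n * \<alpha> + \<delta> + \<alpha> / 2 = real (Suc n) * \<alpha> + \<delta> - \<alpha> / 2"
        by (simp add: field_simps)
      moreover have "2 * sin (\<alpha> / 2) * sin (real (Suc n) * \<alpha> + \<delta>)
          = cos (real (Suc n) * \<alpha> + \<delta> - \<alpha> / 2) - cos (real (Suc n) * \<alpha> + \<delta> + \<alpha> / 2)"
        by (simp only: cos_add[of _ "\<alpha> / 2"] cos_diff[of _ "\<alpha> / 2"]) simp
      moreover have "(\<Sum>k=m..Suc n. sin (real k * \<alpha> + \<delta>))
          = (\<Sum>k=m..n. sin (real k * \<alpha> + \<delta>)) + sin (real (Suc n) * \<alpha> + \<delta>)"
        using step.hyps by simp
      ultimately show ?case using step.IH by (simp only: distrib_left)
    qed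
    then have "\<bar>2 * sin (\<alpha> / 2) * (\<Sum>k=m..n. sin (real k * \<alpha> + \<delta>))\<bar> \<le> 2"
      using abs_cos_le_one[of "real m * \<alpha> + \<delta> - \<alpha> / 2"] abs_cos_le_one[of "real n * \<alpha> + \<delta> + \<alpha> / 2"]
      by linarith
    then show ?thesis using s by (simp add: abs_mult field_simps)
  qed (use s in auto)
qed

text \<open>Dominated convergence, with the dominating function \<open>w m x * B\<close> supplied by
  Abel summation.\<close>

lemma sum_has_integral_limit:
  fixes w :: "nat \<Rightarrow> real \<Rightarrow> real" and b I :: "nat \<Rightarrow> real"
  assumes w: "\<And>k. k \<ge> m \<Longrightarrow> (w k has_integral I k) {c..d}"
    and decr: "\<And>k x. k \<ge> m \<Longrightarrow> x \<in> {c<..<d} \<Longrightarrow> w (Suc k) x \<le> w k x"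
    and nonneg: "\<And>k x. k \<ge> m \<Longrightarrow> x \<in> {c<..<d} \<Longrightarrow> 0 \<le> w k x"
    and b: "\<And>n. \<bar>\<Sum>k=m..n. b k\<bar> \<le> B"
    and lim: "\<And>x. x \<in> {c<..<d} \<Longrightarrow> (\<lambda>N. \<Sum>k=m..N. w k x * b k) \<longlonglongrightarrow> g x"
    and g: "(g has_integral J) {c..d}"
  shows "(\<lambda>N. \<Sum>k=m..N. I k * b k) \<longlonglongrightarrow> J"
proof -
  \<comment> \<open>Working on the open interval avoids the endpoints, where the pointwise limit is
    not assumed; in the applications these may be 0 and 1.\<close>
  let ?S = "{c<..<d}"
  have int: "((\<lambda>x. \<Sum>k=m..N. w k x * b k) has_integral (\<Sum>k=m..N. I k * b k)) ?S" for N
    using w by (intro has_integral_sum has_integral_mult_left)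
      (auto simp: has_integral_Icc_iff_Ioo)
  have "(\<lambda>N. integral ?S (\<lambda>x. \<Sum>k=m..N. w k x * b k)) \<longlonglongrightarrow> integral ?S g"
  proof (rule dominated_convergence(2))
    show "(\<lambda>x. \<Sum>k=m..N. w k x * b k) integrable_on ?S" for N
      using int by (rule has_integral_integrable)
    show "(\<lambda>x. w m x * B) integrable_on ?S"
      using has_integral_mult_left[OF w[of m], of B]
      by (auto simp: has_integral_Icc_iff_Ioo dest: has_integral_integrable)
    show "norm (\<Sum>k=m..N. w k x * b k) \<le> w m x * B" if "x \<in> ?S" for N x
      using abel_summation_bound[of b m B "\<lambda>k. w k x" N] b decr nonneg that by simp
  qed (rule lim)
  then show ?thesis
    using g by (simp add: int[THEN integral_unique] integral_unique has_integral_Icc_iff_Ioo)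
qed

lemma has_integral_reflect_unit:
  fixes f :: "real \<Rightarrow> real"
  assumes "((\<lambda>y. f (1 - y)) has_integral I) {0..1/2}"
  shows "(f has_integral I) {1/2..1}"
  using has_integral_affinity[of "\<lambda>y. f (1 - y)" I 0 "1/2" "-1" 1] assms
  by (simp add: image_affinity_atLeastAtMost_diff)

section \<open>Quotient integrals and the digamma function\<close>

text \<open>The alternating series \<open>\<Sum>n. (-1)^n / (n + \<nu>)\<close>.\<close>

definition beta_series :: "real \<Rightarrow> real" where
  "beta_series \<nu> = (Digamma ((\<nu> + 1) / 2) - Digamma (\<nu> / 2)) / 2"

lemma beta_series_plus1:
  assumes "0 < \<nu>"
  shows "beta_series (\<nu> + 1) = 1 / \<nu> - beta_series \<nu>"
proof -
  have "(\<nu> + 1 + 1) / 2 = \<nu> / 2 + 1" by simp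
  then show ?thesis
    using Digamma_plus1[of "\<nu> / 2"] assms
    by (simp add: beta_series_def) (simp add: field_simps)
qed

text \<open>Monotonicity of \<open>Digamma\<close> makes the values at \<open>\<nu>\<close> and
  \<open>\<nu> + 1\<close> nonnegative, and by the recursion they add up to
  \<open>1 / \<nu>\<close>.\<close>

lemma beta_series_bounds:
  assumes "0 < \<nu>"
  shows "\<bar>beta_series \<nu>\<bar> \<le> 1 / \<nu>"
proof -
  have "0 \<le> beta_series \<mu>" if "0 < \<mu>" for \<mu>
    using Digamma_real_mono[of "\<mu> / 2" "(\<mu> + 1) / 2"] that by (simp add: beta_series_def)
  from this[of \<nu>] this[of "\<nu> + 1"] show ?thesis
    using beta_series_plus1[OF assms] assms by simp
qed

section \<open>The two quotient integrals: integrability, values at 1 and difference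
  formulas\<close>

definition sin_quot_integral :: "real \<Rightarrow> real" where
  "sin_quot_integral m = integral {0..1/2} (\<lambda>y. pi * sin (m * (pi * y)) / sin (pi * y))"

definition cos_quot_integral :: "real \<Rightarrow> real" where
  "cos_quot_integral m = integral {0..1/2} (\<lambda>y. pi * (1 - cos (m * (pi * y))) / sin (pi * y))"

lemma half_angle_range: "y \<in> {0..1/2} \<Longrightarrow> \<bar>pi * y\<bar> < pi"
  by (simp add: abs_mult)

text \<open>At \<open>y = 0\<close> the quotient is 0 by the convention for division, whereas its
  continuous extension has the value \<open>pi * m\<close>; the two differ at one point
  only.\<close>

lemma has_integral_sin_quot:
  "((\<lambda>y. pi * sin (m * (pi * y)) / sin (pi * y)) has_integral sin_quot_integral m) {0..1/2}"
proof -
  have "(\<lambda>y. pi * sin_ratio m (pi * y)) integrable_on {0..1/2}"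
    by (intro integrable_continuous_interval continuous_intros continuous_on_sin_ratio half_angle_range)
  then have "(\<lambda>y. pi * sin (m * (pi * y)) / sin (pi * y)) integrable_on {0..1/2}"
    by (rule integrable_spike_finite[of "{0}", rotated 2]) (auto simp: sin_ratio_def)
  then show ?thesis unfolding sin_quot_integral_def by (rule integrable_integral)
qed

text \<open>The half-angle formula rewrites the numerator as a squared sine, which cancels the zero
  of the denominator.\<close>

lemma has_integral_cos_quot:
  "((\<lambda>y. pi * (1 - cos (m * (pi * y))) / sin (pi * y)) has_integral cos_quot_integral m) {0..1/2}"
proof -
  have "(\<lambda>y. 2 * pi * sin (m / 2 * (pi * y)) * sin_ratio (m / 2) (pi * y)) integrable_on {0..1/2}"
    by (intro integrable_continuous_interval continuous_intros continuous_on_sin_ratio half_angle_range) auto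
  moreover have "2 * pi * sin (m / 2 * (pi * y)) * sin_ratio (m / 2) (pi * y)
      = pi * (1 - cos (m * (pi * y))) / sin (pi * y)" for y
    using cos_double_sin[of "m / 2 * (pi * y)"]
    by (simp add: sin_ratio_def power2_eq_square mult_ac)
  ultimately have "(\<lambda>y. pi * (1 - cos (m * (pi * y))) / sin (pi * y)) integrable_on {0..1/2}"
    by simp
  then show ?thesis unfolding cos_quot_integral_def by (rule integrable_integral)
qed

lemma sin_quot_integral_1: "sin_quot_integral 1 = pi / 2"
proof -
  have "((\<lambda>y::real. pi) has_integral pi / 2) {0..1/2}"
    using has_integral_const_real[of pi 0 "1/2"] by simp
  then have "((\<lambda>y. pi * sin (1 * (pi * y)) / sin (pi * y)) has_integral pi / 2) {0..1/2}"
  proof (rule has_integral_spike_finite[of "{0}", rotated 2])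
    fix y :: real assume "y \<in> {0..1/2} - {0}"
    then have "0 < sin (pi * y)" by (intro sin_gt_zero) auto
    then show "pi * sin (1 * (pi * y)) / sin (pi * y) = pi" by simp
  qed auto
  with has_integral_sin_quot show ?thesis by (rule has_integral_unique)
qed

lemma cos_quot_integral_1: "cos_quot_integral 1 = ln 2"
proof -
  \<comment> \<open>The integrand is \<open>pi * tan (pi * y / 2)\<close>.\<close>
  have "((\<lambda>y. pi * (1 - cos (1 * (pi * y))) / sin (pi * y)) has_integral
      (- 2 * ln (cos (pi * (1/2) / 2)) - (- 2 * ln (cos (pi * 0 / 2)))) ) {0..1/2}"
  proof (rule fundamental_theorem_of_calculus)
    fix y :: real assume y: "y \<in> {0..1/2}"
    have c: "0 < cos (pi * y / 2)" 
    proof (rule cos_gt_zero_pi)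
      have "0 \<le> pi * y" "pi * y \<le> pi * (1/2)" using y by (auto intro: mult_left_mono)
      then show "- (pi / 2) < pi * y / 2" "pi * y / 2 < pi / 2" using pi_gt_zero by linarith+
    qed
    have "((\<lambda>y. - 2 * ln (cos (pi * y / 2))) has_real_derivative pi * sin (pi * y / 2) / cos (pi * y / 2)) (at y within {0..1/2})"
      using c by (auto intro!: derivative_eq_intros)
    moreover have "pi * sin (pi * y / 2) / cos (pi * y / 2) = pi * (1 - cos (1 * (pi * y))) / sin (pi * y)"
    proof -
      have "1 - cos (1 * (pi * y)) = 2 * sin (pi * y / 2) * sin (pi * y / 2)"
        "sin (pi * y) = 2 * sin (pi * y / 2) * cos (pi * y / 2)"
        using cos_double_sin[of "pi * y / 2"] sin_double[of "pi * y / 2"]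
        by (simp_all add: power2_eq_square)
      then show ?thesis using c by (simp only:) simp
    qed
    ultimately show "((\<lambda>y. - 2 * ln (cos (pi * y / 2))) has_vector_derivative
        pi * (1 - cos (1 * (pi * y))) / sin (pi * y)) (at y within {0..1/2})"
      by (simp add: has_real_derivative_iff_has_vector_derivative)
  qed simp
  with has_integral_cos_quot have "cos_quot_integral 1 = - 2 * ln (cos (pi * (1/2) / 2)) - (- 2 * ln (cos (pi * 0 / 2)))"
    by (rule has_integral_unique)
  also have "\<dots> = ln 2" by (simp add: cos_45 ln_div ln_sqrt)
  finally show ?thesis .
qed

text \<open>Sum-to-product gives an amplitude depending on \<open>c\<close> alone times an
  oscillation of frequency governed by \<open>m\<close>. This serves twice: \<open>c = 2\<close>
  gives the exact recursion, and \<open>m\<close> tending to infinity gives decay by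
  Riemann-Lebesgue.\<close>

lemma has_integral_sin_quot_diff:
  "((\<lambda>y. 2 * pi * sin_ratio (c / 2) (pi * y) * cos ((m + c / 2) * (pi * y))) has_integral
     (sin_quot_integral (m + c) - sin_quot_integral m)) {0..1/2}"
proof (rule has_integral_spike_finite[OF _ _ has_integral_diff[OF has_integral_sin_quot has_integral_sin_quot]])
  fix y :: real assume y: "y \<in> {0..1/2} - {0}"
  then have s: "0 < sin (pi * y)" by (intro sin_gt_zero) auto
  have "sin ((m + c) * (pi * y)) - sin (m * (pi * y))
      = 2 * sin (c / 2 * (pi * y)) * cos ((m + c / 2) * (pi * y))"
    unfolding sin_diff_sin by (simp add: field_simps)
  also have "sin (c / 2 * (pi * y)) = sin_ratio (c / 2) (pi * y) * sin (pi * y)"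
    using y half_angle_range by (subst sin_ratio_mult_sin) auto
  finally show "2 * pi * sin_ratio (c / 2) (pi * y) * cos ((m + c / 2) * (pi * y))
      = pi * sin ((m + c) * (pi * y)) / sin (pi * y) - pi * sin (m * (pi * y)) / sin (pi * y)"
    using s by (simp add: diff_divide_distrib[symmetric] right_diff_distrib[symmetric])
qed auto

lemma has_integral_cos_quot_diff:
  "((\<lambda>y. 2 * pi * sin_ratio (c / 2) (pi * y) * sin ((m + c / 2) * (pi * y))) has_integral
     (cos_quot_integral (m + c) - cos_quot_integral m)) {0..1/2}"
proof (rule has_integral_spike_finite[OF _ _ has_integral_diff[OF has_integral_cos_quot has_integral_cos_quot]])
  fix y :: real assume y: "y \<in> {0..1/2} - {0}"
  then have s: "0 < sin (pi * y)" by (intro sin_gt_zero) auto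
  have "cos (m * (pi * y)) - cos ((m + c) * (pi * y))
      = 2 * sin ((m + c / 2) * (pi * y)) * sin (c / 2 * (pi * y))"
    unfolding cos_diff_cos by (simp add: field_simps)
  also have "sin (c / 2 * (pi * y)) = sin_ratio (c / 2) (pi * y) * sin (pi * y)"
    using y half_angle_range by (subst sin_ratio_mult_sin) auto
  finally have "1 - cos ((m + c) * (pi * y)) - (1 - cos (m * (pi * y)))
     = 2 * sin ((m + c / 2) * (pi * y)) * (sin_ratio (c / 2) (pi * y) * sin (pi * y))"
    by simp
  then show "2 * pi * sin_ratio (c / 2) (pi * y) * sin ((m + c / 2) * (pi * y))
      = pi * (1 - cos ((m + c) * (pi * y))) / sin (pi * y) - pi * (1 - cos (m * (pi * y))) / sin (pi * y)"
    using s by (simp only: diff_divide_distrib[symmetric] right_diff_distrib[symmetric]) simp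
qed auto

lemma sin_quot_integral_step:
  assumes "\<nu> \<noteq> 0"
  shows "sin_quot_integral (2 * (\<nu> + 1) - 1) = sin_quot_integral (2 * \<nu> - 1) + sin (pi * \<nu>) / \<nu>"
proof -
  \<comment> \<open>For the shift \<open>c = 2\<close> the amplitude \<open>sin_ratio 1\<close> is
    identically 1, so the integral is elementary.\<close>
  have "((\<lambda>y. 2 * pi * sin_ratio (2 / 2) (pi * y) * cos ((2 * \<nu> - 1 + 2 / 2) * (pi * y))) has_integral
     (sin_quot_integral (2 * \<nu> - 1 + 2) - sin_quot_integral (2 * \<nu> - 1))) {0..1/2}"
    by (rule has_integral_sin_quot_diff)
  moreover have "sin_ratio 1 v = 1" if "\<bar>v\<bar> < pi" for v
    using that sin_eq_0_pi[of v] by (auto simp: sin_ratio_def abs_less_iff)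
  ultimately have "((\<lambda>y. 2 * pi * cos (2 * \<nu> * pi * y + 0)) has_integral
     (sin_quot_integral (2 * \<nu> - 1 + 2) - sin_quot_integral (2 * \<nu> - 1))) {0..1/2}"
    by (elim has_integral_eq[rotated]) (simp add: half_angle_range mult_ac)
  moreover have "((\<lambda>y. 2 * pi * cos (2 * \<nu> * pi * y + 0)) has_integral
     2 * pi * ((sin (2 * \<nu> * pi * (1/2) + 0) - sin (2 * \<nu> * pi * 0 + 0)) / (2 * \<nu> * pi))) {0..1/2}"
    using assms by (intro has_integral_mult_right has_integral_cos_affine) auto
  ultimately have "sin_quot_integral (2 * \<nu> - 1 + 2) - sin_quot_integral (2 * \<nu> - 1)
    = 2 * pi * ((sin (2 * \<nu> * pi * (1/2) + 0) - sin (2 * \<nu> * pi * 0 + 0)) / (2 * \<nu> * pi))"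
    by (rule has_integral_unique)
  also have "\<dots> = sin (pi * \<nu>) / \<nu>"
    using assms by (simp add: mult_ac)
  finally show ?thesis by (simp add: algebra_simps)
qed

lemma cos_quot_integral_step:
  assumes "\<nu> \<noteq> 0"
  shows "cos_quot_integral (2 * (\<nu> + 1) - 1) = cos_quot_integral (2 * \<nu> - 1) + (1 - cos (pi * \<nu>)) / \<nu>"
proof -
  have "((\<lambda>y. 2 * pi * sin_ratio (2 / 2) (pi * y) * sin ((2 * \<nu> - 1 + 2 / 2) * (pi * y))) has_integral
     (cos_quot_integral (2 * \<nu> - 1 + 2) - cos_quot_integral (2 * \<nu> - 1))) {0..1/2}"
    by (rule has_integral_cos_quot_diff)
  moreover have "sin_ratio 1 v = 1" if "\<bar>v\<bar> < pi" for v
    using that sin_eq_0_pi[of v] by (auto simp: sin_ratio_def abs_less_iff)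
  moreover have "cos (v - pi / 2) = sin v" for v by (simp add: cos_diff)
  ultimately have "((\<lambda>y. 2 * pi * cos (2 * \<nu> * pi * y + - (pi / 2))) has_integral
     (cos_quot_integral (2 * \<nu> - 1 + 2) - cos_quot_integral (2 * \<nu> - 1))) {0..1/2}"
    by (elim has_integral_eq[rotated]) (simp add: half_angle_range mult_ac)
  moreover have "((\<lambda>y. 2 * pi * cos (2 * \<nu> * pi * y + - (pi / 2))) has_integral
     2 * pi * ((sin (2 * \<nu> * pi * (1/2) + - (pi / 2)) - sin (2 * \<nu> * pi * 0 + - (pi / 2))) / (2 * \<nu> * pi))) {0..1/2}"
    using assms by (intro has_integral_mult_right has_integral_cos_affine) auto
  ultimately have "cos_quot_integral (2 * \<nu> - 1 + 2) - cos_quot_integral (2 * \<nu> - 1)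
    = 2 * pi * ((sin (2 * \<nu> * pi * (1/2) + - (pi / 2)) - sin (2 * \<nu> * pi * 0 + - (pi / 2))) / (2 * \<nu> * pi))"
    by (rule has_integral_unique)
  also have "\<dots> = (1 - cos (pi * \<nu>)) / \<nu>"
    using assms by (simp add: sin_diff mult_ac) (simp add: field_simps)
  finally show ?thesis by (simp add: algebra_simps)
qed

section \<open>Closed forms of the quotient integrals by periodicity\<close>

lemma periodic_eq_1:
  fixes D :: "real \<Rightarrow> real"
  assumes per: "\<And>x. 0 < x \<Longrightarrow> D (x + 1) = D x" and \<nu>: "0 < \<nu>"
    and lim: "(\<lambda>n. D (real n + \<nu>) - D (real n + 1)) \<longlonglongrightarrow> 0"
  shows "D \<nu> = D 1"
proof -
  have "D (real n + x) = D x" if "0 < x" for n x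
  proof (induction n)
    case (Suc n)
    have "D (real (Suc n) + x) = D ((real n + x) + 1)" by (simp add: algebra_simps)
    then show ?case using per[of "real n + x"] that Suc by simp
  qed simp
  \<comment> \<open>By periodicity the sequence tending to 0 is constant.\<close>
  then have "(\<lambda>n. D \<nu> - D 1) \<longlonglongrightarrow> 0" using lim \<nu> by simp
  then show ?thesis by (simp add: LIMSEQ_const_iff)
qed

lemma bounded_mult_beta_series_tendsto_0:
  assumes "\<And>x. \<bar>h x\<bar> \<le> 1" "0 < \<nu>"
  shows "(\<lambda>n. h (real n + \<nu>) * beta_series (real n + \<nu>)) \<longlonglongrightarrow> 0"
proof (rule Lim_null_comparison)
  show "(\<lambda>n. 1 / (real n + \<nu>)) \<longlonglongrightarrow> 0" by real_asymp
  have "\<bar>h (real n + \<nu>) * beta_series (real n + \<nu>)\<bar> \<le> 1 * (1 / (real n + \<nu>))" for n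
    unfolding abs_mult using assms(2) by (intro mult_mono assms(1) beta_series_bounds) auto
  then show "\<forall>\<^sub>F n in sequentially. norm (h (real n + \<nu>) * beta_series (real n + \<nu>)) \<le> 1 / (real n + \<nu>)"
    by simp
qed

lemma sin_quot_integral_eq:
  assumes \<nu>: "0 < \<nu>"
  shows "sin_quot_integral (2 * \<nu> - 1) = pi / 2 - sin (pi * \<nu>) * beta_series \<nu>"
proof -
  \<comment> \<open>Under a unit shift both the sine and \<open>beta_series\<close> flip sign, the
    latter up to \<open>1 / x\<close>; this remainder cancels the increment of the integral.\<close>
  define D where "D = (\<lambda>\<nu>. sin_quot_integral (2 * \<nu> - 1) + sin (pi * \<nu>) * beta_series \<nu>)"
  have "D \<nu> = D 1"
  proof (rule periodic_eq_1)
    show "D (x + 1) = D x" if "0 < x" for x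
    proof -
      have "sin (pi * (x + 1)) = - sin (pi * x)" by (simp add: distrib_left)
      moreover have "x \<noteq> 0" using that by simp
      ultimately show ?thesis
        by (simp only: D_def sin_quot_integral_step[OF \<open>x \<noteq> 0\<close>] beta_series_plus1[OF that]) (simp add: algebra_simps)
    qed
    \<comment> \<open>Chosen so that \<open>2 * (n + \<nu>) - 1\<close> is
      \<open>2 * n + 1 + c\<close>. The phase \<open>pi / 2\<close> below turns the sine into the
      cosine of the difference formula.\<close>
    define c where "c = 2 * \<nu> - 2"
    have "(\<lambda>n. integral {0..1/2} (\<lambda>y. 2 * pi * sin_ratio (c / 2) (pi * y) * sin (pi * (2 * real n + 1 + c / 2) * y + pi / 2))) \<longlonglongrightarrow> 0"
    proof (rule riemann_lebesgue)
      show "continuous_on {0..1/2} (\<lambda>y. 2 * pi * sin_ratio (c / 2) (pi * y))"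
        by (intro continuous_intros continuous_on_sin_ratio half_angle_range)
      show "filterlim (\<lambda>n. pi * (2 * real n + 1 + c / 2)) at_top sequentially"
        by real_asymp
    qed simp
    moreover have "integral {0..1/2} (\<lambda>y. 2 * pi * sin_ratio (c / 2) (pi * y) * sin (pi * (2 * real n + 1 + c / 2) * y + pi / 2))
        = sin_quot_integral (2 * (real n + \<nu>) - 1) - sin_quot_integral (2 * (real n + 1) - 1)" for n
    proof -
      have *: "2 * (real n + \<nu>) - 1 = 2 * real n + 1 + c" "2 * (real n + 1) - 1 = 2 * real n + 1"
        by (simp_all add: c_def)
      show ?thesis
        unfolding *
        using integral_unique[OF has_integral_sin_quot_diff[of c "2 * real n + 1"]]
        by (simp add: sin_add mult_ac)
    qed
    ultimately have "(\<lambda>n. sin_quot_integral (2 * (real n + \<nu>) - 1) - sin_quot_integral (2 * (real n + 1) - 1)) \<longlonglongrightarrow> 0"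
      by simp
    moreover have "(\<lambda>n. sin (pi * (real n + x)) * beta_series (real n + x)) \<longlonglongrightarrow> 0" if "0 < x" for x
      using that by (intro bounded_mult_beta_series_tendsto_0[where h="\<lambda>x. sin (pi * x)"]) auto
    ultimately have "(\<lambda>n. (sin_quot_integral (2 * (real n + \<nu>) - 1) - sin_quot_integral (2 * (real n + 1) - 1))
       + (sin (pi * (real n + \<nu>)) * beta_series (real n + \<nu>) - sin (pi * (real n + 1)) * beta_series (real n + 1))) \<longlonglongrightarrow> 0 + (0 - 0)"
      using \<nu> by (intro tendsto_add tendsto_diff) auto
    then show "(\<lambda>n. D (real n + \<nu>) - D (real n + 1)) \<longlonglongrightarrow> 0"
      by (simp add: D_def algebra_simps)
  qed (rule \<nu>)
  then show ?thesis by (simp add: D_def sin_quot_integral_1)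
qed

text \<open>Monotonicity confines both values to an interval between consecutive integers, on which
  \<open>Digamma\<close> grows by only \<open>1 / n\<close>.\<close>

lemma Digamma_shift_diff_tendsto_0:
  fixes \<nu> :: real
  assumes "0 < \<nu>" "\<nu> < 1"
  shows "(\<lambda>n. Digamma (real n + \<nu>) - Digamma (real n + 1)) \<longlonglongrightarrow> 0"
proof (rule Lim_null_comparison)
  show "(\<lambda>n. 1 / real n) \<longlonglongrightarrow> 0" by real_asymp
  have "\<bar>Digamma (real n + \<nu>) - Digamma (real n + 1)\<bar> \<le> 1 / real n" if "n > 0" for n
  proof -
    have "Digamma (real n) \<le> Digamma (real n + \<nu>)" "Digamma (real n + \<nu>) \<le> Digamma (real n + 1)"
      using that assms by (auto intro!: Digamma_real_mono)
    then show ?thesis using Digamma_plus1[of "real n"] that by simp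
  qed
  then show "\<forall>\<^sub>F n in sequentially. norm (Digamma (real n + \<nu>) - Digamma (real n + 1)) \<le> 1 / real n"
    by (intro eventually_sequentiallyI[of 1]) simp
qed

lemma cos_quot_integral_eq:
  assumes \<nu>: "0 < \<nu>" "\<nu> < 1"
  shows "cos_quot_integral (2 * \<nu> - 1) = Digamma \<nu> - Digamma 1 + 2 * ln 2 + cos (pi * \<nu>) * beta_series \<nu>"
proof -
  \<comment> \<open>The increment \<open>(1 - cos (pi * x)) / x\<close> of the integral splits:
    \<open>Digamma\<close> accounts for \<open>1 / x\<close>, the \<open>beta_series\<close> term
    for the cosine part.\<close>
  define D where "D = (\<lambda>\<nu>. cos_quot_integral (2 * \<nu> - 1) - Digamma \<nu> - cos (pi * \<nu>) * beta_series \<nu>)"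
  have "D \<nu> = D 1"
  proof (rule periodic_eq_1)
    show "D (x + 1) = D x" if "0 < x" for x
    proof -
      have "cos (pi * (x + 1)) = - cos (pi * x)" by (simp add: distrib_left)
      moreover have "x \<noteq> 0" using that by simp
      ultimately show ?thesis
        by (simp only: D_def cos_quot_integral_step[OF \<open>x \<noteq> 0\<close>] beta_series_plus1[OF that]
            Digamma_plus1[OF \<open>x \<noteq> 0\<close>])
          (simp add: algebra_simps diff_divide_distrib)
    qed
    define c where "c = 2 * \<nu> - 2"
    have "(\<lambda>n. integral {0..1/2} (\<lambda>y. 2 * pi * sin_ratio (c / 2) (pi * y) * sin (pi * (2 * real n + 1 + c / 2) * y + 0))) \<longlonglongrightarrow> 0"
    proof (rule riemann_lebesgue)
      show "continuous_on {0..1/2} (\<lambda>y. 2 * pi * sin_ratio (c / 2) (pi * y))"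
        by (intro continuous_intros continuous_on_sin_ratio half_angle_range)
      show "filterlim (\<lambda>n. pi * (2 * real n + 1 + c / 2)) at_top sequentially"
        by real_asymp
    qed simp
    moreover have "integral {0..1/2} (\<lambda>y. 2 * pi * sin_ratio (c / 2) (pi * y) * sin (pi * (2 * real n + 1 + c / 2) * y + 0))
        = cos_quot_integral (2 * (real n + \<nu>) - 1) - cos_quot_integral (2 * (real n + 1) - 1)" for n
    proof -
      have *: "2 * (real n + \<nu>) - 1 = 2 * real n + 1 + c" "2 * (real n + 1) - 1 = 2 * real n + 1"
        by (simp_all add: c_def)
      show ?thesis
        unfolding *
        using integral_unique[OF has_integral_cos_quot_diff[of c "2 * real n + 1"]]
        by (simp add: mult_ac)
    qed
    ultimately have "(\<lambda>n. cos_quot_integral (2 * (real n + \<nu>) - 1) - cos_quot_integral (2 * (real n + 1) - 1)) \<longlonglongrightarrow> 0"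
      by simp
    moreover have "(\<lambda>n. cos (pi * (real n + x)) * beta_series (real n + x)) \<longlonglongrightarrow> 0" if "0 < x" for x
      using that by (intro bounded_mult_beta_series_tendsto_0[where h="\<lambda>x. cos (pi * x)"]) auto
    ultimately have "(\<lambda>n. (cos_quot_integral (2 * (real n + \<nu>) - 1) - cos_quot_integral (2 * (real n + 1) - 1))
       - (Digamma (real n + \<nu>) - Digamma (real n + 1))
       - (cos (pi * (real n + \<nu>)) * beta_series (real n + \<nu>) - cos (pi * (real n + 1)) * beta_series (real n + 1))) \<longlonglongrightarrow> 0 - 0 - (0 - 0)"
      using \<nu> by (intro tendsto_diff Digamma_shift_diff_tendsto_0) auto
    then show "(\<lambda>n. D (real n + \<nu>) - D (real n + 1)) \<longlonglongrightarrow> 0"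
      by (simp add: D_def algebra_simps)
  qed (rule \<nu>)
  \<comment> \<open>At \<open>\<nu> = 1\<close> the integral contributes one \<open>ln 2\<close>,
    and \<open>beta_series\<close> a second one because \<open>cos pi = -1\<close>.\<close>
  moreover have "beta_series 1 = ln 2"
    by (simp add: beta_series_def Digamma_one_half)
  ultimately show ?thesis by (simp add: D_def cos_quot_integral_1)
qed

text \<open>After reflection the omitted term \<open>k = 1\<close> and the Fourier limit both have a
  pole at \<open>y = 0\<close>; only their difference is integrable.\<close>

lemma has_integral_pole_difference:
  "((\<lambda>y. 1 / y - pi / sin (pi * y)) has_integral ln (pi / 4)) {0..1/2}"
proof -
  \<comment> \<open>The antiderivative \<open>ln y - ln (tan (pi * y / 2))\<close>, extended to
    \<open>0\<close> by its limit. Continuity there suffices for the interior form of the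
    fundamental theorem.\<close>
  define F where "F = (\<lambda>y. if y = 0 then - ln (pi / 2) else ln y + ln (cos (pi * y / 2)) - ln (sin (pi * y / 2)))"
  have pos: "0 < sin (pi * y / 2)" "0 < cos (pi * y / 2)" if "0 < y" "y \<le> 1/2" for y
  proof -
    have "0 < pi * y" "pi * y \<le> pi * (1/2)" using that by (auto intro: mult_left_mono)
    then have "0 < pi * y / 2" "pi * y / 2 < pi / 2" using pi_gt_zero by linarith+
    then show "0 < sin (pi * y / 2)" "0 < cos (pi * y / 2)"
      by (auto intro!: sin_gt_zero cos_gt_zero simp del: zero_less_divide_iff)
  qed
  have deriv: "(F has_real_derivative 1 / y - pi / sin (pi * y)) (at y)" if y: "0 < y" "y \<le> 1/2" for y
  proof -
    have D: "((\<lambda>y. ln y + ln (cos (pi * y / 2)) - ln (sin (pi * y / 2))) has_real_derivative 1 / y - pi / sin (pi * y)) (at y)"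
    proof -
      have "sin (pi * y) = 2 * sin (pi * y / 2) * cos (pi * y / 2)"
        using sin_double[of "pi * y / 2"] by simp
      moreover have "cos (pi * y / 2) * cos (pi * y / 2) + sin (pi * y / 2) * sin (pi * y / 2) = 1"
        using sin_cos_squared_add2[of "pi * y / 2"] by (simp add: power2_eq_square)
      moreover have "pi / (2 * s * c) = pi / 2 * (s / c) + pi / 2 * (c / s)"
        if "0 < s" "0 < c" "c * c + s * s = 1" for s c :: real
      proof -
        have "pi / 2 * (s / c) + pi / 2 * (c / s) = pi * (c * c + s * s) / (2 * s * c)"
          using that(1,2) by (simp add: field_simps)
        then show ?thesis using that(3) by simp
      qed
      ultimately have "pi / sin (pi * y) = pi / 2 * (sin (pi * y / 2) / cos (pi * y / 2))
          + pi / 2 * (cos (pi * y / 2) / sin (pi * y / 2))"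
        using pos[OF y] by simp
      then show ?thesis
        using y pos[OF y] by (auto intro!: derivative_eq_intros simp: mult_ac)
    qed
    have "eventually (\<lambda>x. x \<noteq> 0) (nhds y)"
      using y by (intro t1_space_nhds) auto
    then have ev: "eventually (\<lambda>x. ln x + ln (cos (pi * x / 2)) - ln (sin (pi * x / 2)) = F x) (nhds y)"
      by eventually_elim (simp add: F_def)
    show ?thesis using DERIV_cong_ev[OF refl ev refl] D by blast
  qed
  have "((\<lambda>y. ln y + ln (cos (pi * y / 2)) - ln (sin (pi * y / 2))) \<longlongrightarrow> - ln (pi / 2)) (at_right 0)"
    by real_asymp
  then have "(F \<longlongrightarrow> - ln (pi / 2)) (at_right 0)"
    by (rule Lim_transform_eventually) (auto simp: F_def eventually_at_filter)
  then have F0: "continuous (at 0 within {0..1/2}) F"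
    by (simp add: continuous_within F_def at_within_Icc_at_right)
  have "((\<lambda>y. 1 / y - pi / sin (pi * y)) has_integral F (1/2) - F 0) {0..1/2}"
  proof (rule fundamental_theorem_of_calculus_interior)
    show "continuous_on {0..1/2} F"
      unfolding continuous_on_eq_continuous_within
    proof
      fix y :: real assume "y \<in> {0..1/2}"
      then show "continuous (at y within {0..1/2}) F"
        using F0 DERIV_isCont[OF deriv[of y]] by (cases "y = 0") (auto intro: continuous_at_imp_continuous_at_within)
    qed
    show "(F has_vector_derivative 1 / y - pi / sin (pi * y)) (at y)" if "y \<in> {0<..<1/2}" for y
      using deriv[of y] that by (simp add: has_real_derivative_iff_has_vector_derivative)
  qed simp
  moreover have "F (1/2) - F 0 = ln (pi / 4)"
    using ln_realpow[of 2 2] by (simp add: F_def cos_45 sin_45 ln_div ln_mult)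
  ultimately show ?thesis by simp
qed

section \<open>The logarithmic series\<close>

lemma has_integral_sin_weight:
  fixes a b :: real and k :: nat
  assumes "0 \<le> a" "a \<le> b" "b < real k"
  shows "((\<lambda>x. 2 * real k / ((real k)\<^sup>2 - x\<^sup>2)) has_integral
     ln ((real k + b) / (real k - b)) - ln ((real k + a) / (real k - a))) {a..b}"
proof (rule fundamental_theorem_of_calculus)
  fix x assume "x \<in> {a..b}"
  then have "0 < real k - x" "0 < real k + x" using assms by auto
  moreover have "(real k)\<^sup>2 - x\<^sup>2 = (real k - x) * (real k + x)"
    by (simp add: power2_eq_square algebra_simps)
  ultimately show "((\<lambda>x. ln ((real k + x) / (real k - x))) has_vector_derivative
      2 * real k / ((real k)\<^sup>2 - x\<^sup>2)) (at x within {a..b})"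
    unfolding has_real_derivative_iff_has_vector_derivative[symmetric]
    by (auto intro!: derivative_eq_intros simp: divide_simps)
qed (rule assms)

section \<open>Integrals of the Fourier limits with the term \<open>k = 1\<close> removed\<close>

lemma has_integral_sin_integrand_lower:
  "((\<lambda>x. - (pi * sin (m * (pi * x)) / sin (pi * x)) - a * (2 / (1 - x\<^sup>2))) has_integral
     - sin_quot_integral m - a * ln 3) {0..1/2}"
proof -
  have "((\<lambda>x. 2 / (1 - x\<^sup>2)) has_integral ln 3) {0..1/2::real}"
    using has_integral_sin_weight[of 0 "1/2" 1] by simp
  then show ?thesis
    by (intro has_integral_diff has_integral_neg has_integral_mult_right has_integral_sin_quot)
qed

text \<open>After \<open>x = 1 - y\<close>, the removed term becomes
  \<open>1 / y + 1 / (2 - y)\<close>. Writing \<open>cos t / sin\<close> as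
  \<open>1 / sin - (1 - cos t) / sin\<close> isolates the pole \<open>pi / sin (pi * y)\<close>,
  which cancels against \<open>1 / y\<close>.\<close>

lemma has_integral_sin_integrand_upper:
  assumes "m = 2 * \<nu> - 1" "\<alpha> = 2 * pi * \<nu>"
  shows "((\<lambda>x. - (pi * sin (m * (pi * x)) / sin (pi * x)) - sin \<alpha> * (2 / (1 - x\<^sup>2))) has_integral
     - cos \<alpha> * sin_quot_integral m - sin \<alpha> * (cos_quot_integral m + ln (pi / 3))) {1/2..1}"
proof (rule has_integral_reflect_unit)
  have "((\<lambda>y. 1 / (2 - y)) has_integral (- ln (2 - 1/2) - (- ln (2 - 0)))) {0..1/2::real}"
    by (rule fundamental_theorem_of_calculus)
      (auto intro!: derivative_eq_intros simp: has_real_derivative_iff_has_vector_derivative[symmetric] field_simps)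
  from has_integral_add[OF has_integral_pole_difference this]
  have "((\<lambda>y. 1 / y - pi / sin (pi * y) + 1 / (2 - y)) has_integral ln (pi / 3)) {0..1/2}"
    using ln_realpow[of 2 2] by (simp add: ln_div)
  then have "((\<lambda>y. - cos \<alpha> * (pi * sin (m * (pi * y)) / sin (pi * y))
      - sin \<alpha> * (pi * (1 - cos (m * (pi * y))) / sin (pi * y) + (1 / y - pi / sin (pi * y) + 1 / (2 - y)))) has_integral
     - cos \<alpha> * sin_quot_integral m - sin \<alpha> * (cos_quot_integral m + ln (pi / 3))) {0..1/2}"
    by (intro has_integral_diff has_integral_add has_integral_mult_right has_integral_sin_quot has_integral_cos_quot)
  then show "((\<lambda>y. - (pi * sin (m * (pi * (1 - y))) / sin (pi * (1 - y))) - sin \<alpha> * (2 / (1 - (1 - y)\<^sup>2))) has_integral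
     - cos \<alpha> * sin_quot_integral m - sin \<alpha> * (cos_quot_integral m + ln (pi / 3))) {0..1/2}"
  proof (rule has_integral_spike_finite[of "{0}", rotated 2])
    fix y :: real assume y: "y \<in> {0..1/2} - {0}"
    have "sin (m * (pi * (1 - y))) = - sin \<alpha> * cos (m * (pi * y)) + cos \<alpha> * sin (m * (pi * y))"
    proof -
      \<comment> \<open>The choice of \<open>m\<close> makes
        \<open>m * pi = \<alpha> - pi\<close>.\<close>
      have "m * (pi * (1 - y)) = (\<alpha> - m * (pi * y)) - pi"
        by (simp add: assms algebra_simps)
      then show ?thesis by (simp add: sin_diff)
    qed
    moreover have "sin (pi * (1 - y)) = sin (pi * y)"
      by (simp add: right_diff_distrib)
    moreover have "2 / (1 - (1 - y)\<^sup>2) = 1 / y + 1 / (2 - y)"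
      using y by (auto simp: divide_simps) (auto simp: power2_eq_square algebra_simps)
    ultimately show "- (pi * sin (m * (pi * (1 - y))) / sin (pi * (1 - y))) - sin \<alpha> * (2 / (1 - (1 - y)\<^sup>2))
       = - cos \<alpha> * (pi * sin (m * (pi * y)) / sin (pi * y))
      - sin \<alpha> * (pi * (1 - cos (m * (pi * y))) / sin (pi * y) + (1 / y - pi / sin (pi * y) + 1 / (2 - y)))"
      by (simp only:) (simp add: algebra_simps diff_divide_distrib add_divide_distrib)
  qed simp
qed

text \<open>The same reflection, where the removed term is \<open>1 / y - 1 / (2 - y)\<close> and
  the extra \<open>1 / x\<close> integrates to \<open>ln 2\<close>. Only this half of the unit
  interval enters the cosine series.\<close>

lemma has_integral_cos_integrand_upper:
  assumes "m = 2 * \<nu> - 1" "\<alpha> = 2 * pi * \<nu>"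
  shows "((\<lambda>x. 1 / x - pi * cos (m * (pi * x)) / sin (pi * x) - cos \<alpha> * (2 * x / (1 - x\<^sup>2))) has_integral
     ln 2 + sin \<alpha> * sin_quot_integral m - cos \<alpha> * (cos_quot_integral m + ln (3 * pi / 16))) {1/2..1}"
proof (rule has_integral_reflect_unit)
  have "((\<lambda>y. 1 / (2 - y)) has_integral (- ln (2 - 1/2) - (- ln (2 - 0)))) {0..1/2::real}"
    by (rule fundamental_theorem_of_calculus)
      (auto intro!: derivative_eq_intros simp: has_real_derivative_iff_has_vector_derivative[symmetric] field_simps)
  from has_integral_diff[OF has_integral_pole_difference this]
  have 1: "((\<lambda>y. 1 / y - pi / sin (pi * y) - 1 / (2 - y)) has_integral
      (ln (pi / 4) - (- ln (2 - 1/2) - (- ln (2 - 0))))) {0..1/2}" .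
  have "ln (16::real) = 4 * ln 2" "ln (4::real) = 2 * ln 2"
    using ln_realpow[of 2 4] ln_realpow[of 2 2] by simp_all
  then have "ln (pi / 4) - (- ln (2 - 1/2) - (- ln (2 - 0))) = ln (3 * pi / 16)"
    by (simp add: ln_div ln_mult)
  with 1 have 1: "((\<lambda>y. 1 / y - pi / sin (pi * y) - 1 / (2 - y)) has_integral ln (3 * pi / 16)) {0..1/2}"
    by simp
  have "((\<lambda>y. 1 / (1 - y)) has_integral (- ln (1 - 1/2) - (- ln (1 - 0)))) {0..1/2::real}"
    by (rule fundamental_theorem_of_calculus)
      (auto intro!: derivative_eq_intros simp: has_real_derivative_iff_has_vector_derivative[symmetric] field_simps)
  then have "((\<lambda>y. 1 / (1 - y)) has_integral ln 2) {0..1/2::real}"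
    by (simp add: ln_div)
  with 1 have "((\<lambda>y. 1 / (1 - y) + sin \<alpha> * (pi * sin (m * (pi * y)) / sin (pi * y))
      - cos \<alpha> * (pi * (1 - cos (m * (pi * y))) / sin (pi * y) + (1 / y - pi / sin (pi * y) - 1 / (2 - y)))) has_integral
     ln 2 + sin \<alpha> * sin_quot_integral m - cos \<alpha> * (cos_quot_integral m + ln (3 * pi / 16))) {0..1/2}"
    by (intro has_integral_diff has_integral_add has_integral_mult_right has_integral_sin_quot has_integral_cos_quot)
  then show "((\<lambda>y. 1 / (1 - y) - pi * cos (m * (pi * (1 - y))) / sin (pi * (1 - y)) - cos \<alpha> * (2 * (1 - y) / (1 - (1 - y)\<^sup>2))) has_integral
     ln 2 + sin \<alpha> * sin_quot_integral m - cos \<alpha> * (cos_quot_integral m + ln (3 * pi / 16))) {0..1/2}"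
  proof (rule has_integral_spike_finite[of "{0}", rotated 2])
    fix y :: real assume y: "y \<in> {0..1/2} - {0}"
    have "cos (m * (pi * (1 - y))) = - cos \<alpha> * cos (m * (pi * y)) - sin \<alpha> * sin (m * (pi * y))"
    proof -
      have "m * (pi * (1 - y)) = (\<alpha> - m * (pi * y)) - pi"
        by (simp add: assms algebra_simps)
      then show ?thesis by (simp add: cos_diff)
    qed
    moreover have "sin (pi * (1 - y)) = sin (pi * y)"
      by (simp add: right_diff_distrib)
    moreover have "2 * (1 - y) / (1 - (1 - y)\<^sup>2) = 1 / y - 1 / (2 - y)"
      using y by (auto simp: divide_simps) (auto simp: power2_eq_square algebra_simps)
    ultimately show "1 / (1 - y) - pi * cos (m * (pi * (1 - y))) / sin (pi * (1 - y)) - cos \<alpha> * (2 * (1 - y) / (1 - (1 - y)\<^sup>2))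
       = 1 / (1 - y) + sin \<alpha> * (pi * sin (m * (pi * y)) / sin (pi * y))
      - cos \<alpha> * (pi * (1 - cos (m * (pi * y))) / sin (pi * y) + (1 / y - pi / sin (pi * y) - 1 / (2 - y)))"
      by (simp only:) (simp add: algebra_simps diff_divide_distrib add_divide_distrib)
  qed simp
qed

lemma tendsto_sum_from_2:
  fixes f :: "nat \<Rightarrow> real"
  assumes "(\<lambda>N. \<Sum>k=1..N. f k) \<longlonglongrightarrow> L"
  shows "(\<lambda>N. \<Sum>k=2..N. f k) \<longlonglongrightarrow> L - f 1"
proof (rule Lim_transform_eventually)
  show "(\<lambda>N. (\<Sum>k=1..N. f k) - f 1) \<longlonglongrightarrow> L - f 1"
    by (intro tendsto_diff assms tendsto_const)
  have "(\<Sum>k=1..N. f k) - f 1 = (\<Sum>k=2..N. f k)" if "N \<ge> 1" for N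
    using sum.atLeast_Suc_atMost[OF that, of f] by (simp add: numeral_2_eq_2)
  then show "\<forall>\<^sub>F N in sequentially. (\<Sum>k=1..N. f k) - f 1 = (\<Sum>k=2..N. f k)"
    by (intro eventually_sequentiallyI[of 1]) simp
qed

lemma partial_fraction_denominator_pos:
  fixes x :: real and k :: nat
  assumes "0 \<le> x" "x \<le> 1" "2 \<le> k"
  shows "0 < (real k)\<^sup>2 - x\<^sup>2"
  using power_strict_mono[of x "real k" 2] assms by simp

text \<open>The weight is \<open>1 / (k - x) + 1 / (k + x)\<close>, and both summands decrease in
  \<open>k\<close>.\<close>

lemma sin_weight_decreasing:
  fixes x :: real and k :: nat
  assumes x: "0 \<le> x" "x \<le> 1" "2 \<le> k"
  shows "2 * real (Suc k) / ((real (Suc k))\<^sup>2 - x\<^sup>2) \<le> 2 * real k / ((real k)\<^sup>2 - x\<^sup>2)"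
proof -
  have *: "2 * real j / ((real j)\<^sup>2 - x\<^sup>2) = 1 / (real j - x) + 1 / (real j + x)" if "2 \<le> j" for j
  proof -
    have "0 < real j - x" "0 < real j + x" using that x by linarith+
    moreover have "(real j)\<^sup>2 - x\<^sup>2 = (real j - x) * (real j + x)"
      by (simp add: power2_eq_square algebra_simps)
    ultimately show ?thesis by (simp add: divide_simps)
  qed
  have "1 / (real (Suc k) - x) \<le> 1 / (real k - x)" "1 / (real (Suc k) + x) \<le> 1 / (real k + x)"
    using x by (auto intro!: divide_left_mono)
  then show ?thesis using x(3) by (subst (1 2) *) (auto intro: add_mono)
qed

lemma has_integral_cos_weight:
  fixes a b :: real and k :: nat
  assumes "0 \<le> a" "a \<le> b" "b \<le> 1" "2 \<le> k"
  shows "((\<lambda>x. 2 * x / ((real k)\<^sup>2 - x\<^sup>2)) has_integral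
     - ln ((real k)\<^sup>2 - b\<^sup>2) - (- ln ((real k)\<^sup>2 - a\<^sup>2))) {a..b}"
proof (rule fundamental_theorem_of_calculus)
  fix x assume "x \<in> {a..b}"
  then have "0 < (real k)\<^sup>2 - x\<^sup>2" using assms by (intro partial_fraction_denominator_pos) auto
  then show "((\<lambda>x. - ln ((real k)\<^sup>2 - x\<^sup>2)) has_vector_derivative
      2 * x / ((real k)\<^sup>2 - x\<^sup>2)) (at x within {a..b})"
    unfolding has_real_derivative_iff_has_vector_derivative[symmetric]
    by (auto intro!: derivative_eq_intros)
qed (rule assms)

section \<open>From the limit integrals to the logarithmic series\<close>

lemma log_sin_series_tendsto:
  fixes \<nu> a b J :: real
  assumes \<nu>: "0 < \<nu>" "\<nu> < 1" and ab: "0 \<le> a" "a \<le> b" "b \<le> 1"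
    and J: "((\<lambda>x. - (pi * sin ((2 * \<nu> - 1) * (pi * x)) / sin (pi * x)) - sin (2 * pi * \<nu>) * (2 / (1 - x\<^sup>2)))
      has_integral J) {a..b}"
  shows "(\<lambda>N. \<Sum>k=2..N. (ln ((real k + b) / (real k - b)) - ln ((real k + a) / (real k - a)))
      * sin (real k * (2 * pi * \<nu>))) \<longlonglongrightarrow> J"
proof (rule sum_has_integral_limit[OF _ _ _ _ _ J])
  let ?\<alpha> = "2 * pi * \<nu>"
  have \<alpha>: "0 < ?\<alpha>" "?\<alpha> < 2 * pi" using \<nu> by auto
  show "\<bar>\<Sum>k=2..n. sin (real k * ?\<alpha>)\<bar> \<le> 1 / sin (?\<alpha> / 2)" for n
    using sum_sin_progression_bound[OF \<alpha>, of 0] by simp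
  fix x assume "x \<in> {a<..<b}"
  then have x: "0 < x" "x < 1" using ab by auto
  have "?\<alpha> - pi = (2 * \<nu> - 1) * pi" by (simp add: algebra_simps)
  then have "sin (x * (pi - ?\<alpha>)) = - sin ((2 * \<nu> - 1) * (pi * x))"
    by (metis minus_diff_eq mult.assoc mult.commute mult_minus_right sin_minus)
  then show "(\<lambda>N. \<Sum>k=2..N. 2 * real k / ((real k)\<^sup>2 - x\<^sup>2) * sin (real k * ?\<alpha>)) \<longlonglongrightarrow>
     - (pi * sin ((2 * \<nu> - 1) * (pi * x)) / sin (pi * x)) - sin ?\<alpha> * (2 / (1 - x\<^sup>2))"
    using tendsto_sum_from_2[OF sum_sin_partial_fractions[OF x \<alpha>]] by (simp add: mult_ac)
  fix k :: nat assume k: "2 \<le> k"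
  show "2 * real (Suc k) / ((real (Suc k))\<^sup>2 - x\<^sup>2) \<le> 2 * real k / ((real k)\<^sup>2 - x\<^sup>2)"
    using x k by (intro sin_weight_decreasing) auto
  show "0 \<le> 2 * real k / ((real k)\<^sup>2 - x\<^sup>2)"
    using partial_fraction_denominator_pos[of x k] x k by simp
qed (use ab in \<open>intro has_integral_sin_weight; simp\<close>)

lemma log_cos_series_tendsto:
  fixes \<nu> a b J :: real
  assumes \<nu>: "0 < \<nu>" "\<nu> < 1" and ab: "0 \<le> a" "a \<le> b" "b \<le> 1"
    and J: "((\<lambda>x. 1 / x - pi * cos ((2 * \<nu> - 1) * (pi * x)) / sin (pi * x) - cos (2 * pi * \<nu>) * (2 * x / (1 - x\<^sup>2)))
      has_integral J) {a..b}"
  shows "(\<lambda>N. \<Sum>k=2..N. (- ln ((real k)\<^sup>2 - b\<^sup>2) - (- ln ((real k)\<^sup>2 - a\<^sup>2)))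
      * cos (real k * (2 * pi * \<nu>))) \<longlonglongrightarrow> J"
proof (rule sum_has_integral_limit[OF _ _ _ _ _ J])
  let ?\<alpha> = "2 * pi * \<nu>"
  have \<alpha>: "0 < ?\<alpha>" "?\<alpha> < 2 * pi" using \<nu> by auto
  show "\<bar>\<Sum>k=2..n. cos (real k * ?\<alpha>)\<bar> \<le> 1 / sin (?\<alpha> / 2)" for n
    \<comment> \<open>The shift by \<open>pi / 2\<close> turns sines into cosines.\<close>
    using sum_sin_progression_bound[OF \<alpha>, of "pi / 2"] by (simp add: sin_add)
  fix x assume "x \<in> {a<..<b}"
  then have x: "0 < x" "x < 1" using ab by auto
  have "?\<alpha> - pi = (2 * \<nu> - 1) * pi" by (simp add: algebra_simps)
  then have "cos (x * (pi - ?\<alpha>)) = cos ((2 * \<nu> - 1) * (pi * x))"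
    by (metis minus_diff_eq mult.assoc mult.commute mult_minus_right cos_minus)
  then show "(\<lambda>N. \<Sum>k=2..N. 2 * x / ((real k)\<^sup>2 - x\<^sup>2) * cos (real k * ?\<alpha>)) \<longlonglongrightarrow>
     1 / x - pi * cos ((2 * \<nu> - 1) * (pi * x)) / sin (pi * x) - cos ?\<alpha> * (2 * x / (1 - x\<^sup>2))"
    using tendsto_sum_from_2[OF sum_cos_partial_fractions[OF x \<alpha>]] by (simp add: mult_ac)
  fix k :: nat assume k: "2 \<le> k"
  have pos: "0 < (real k)\<^sup>2 - x\<^sup>2" using x k by (intro partial_fraction_denominator_pos) auto
  then show "0 \<le> 2 * x / ((real k)\<^sup>2 - x\<^sup>2)" using x by (intro divide_nonneg_pos) auto
  have "(real k)\<^sup>2 \<le> (real (Suc k))\<^sup>2" by (intro power_mono) auto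
  with pos x show "2 * x / ((real (Suc k))\<^sup>2 - x\<^sup>2) \<le> 2 * x / ((real k)\<^sup>2 - x\<^sup>2)"
    by (intro divide_left_mono mult_pos_pos) linarith+
qed (rule has_integral_cos_weight[OF ab])

theorem theorem1:
  fixes \<nu> :: real
  assumes "0 < \<nu>" and "\<nu> < 1"
  shows
    "((\<lambda>N::nat. \<Sum>k=2..N. ln ((real k - 1) / (real k + 1)) * sin (2 * real k * \<nu> * pi))
       \<longlonglongrightarrow> sin (2 * \<nu> * pi) * (ln (4 * pi) - Digamma 1 + Digamma \<nu>) + pi * (cos (\<nu> * pi))\<^sup>2) \<and>
     ((\<lambda>N::nat. \<Sum>k=2..N. ln ((2 * real k - 1) / (2 * real k + 1)) * sin (2 * real k * \<nu> * pi))
       \<longlonglongrightarrow> 1 / 2 * sin (\<nu> * pi) * (Digamma (\<nu> / 2) - Digamma ((\<nu> + 1) / 2))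
           + pi / 2 + ln 3 * sin (2 * \<nu> * pi)) \<and>
     ((\<lambda>N::nat. \<Sum>k=2..N. ln (4 * ((real k)\<^sup>2 - 1) / (4 * (real k)\<^sup>2 - 1)) * cos (2 * real k * \<nu> * pi))
       \<longlonglongrightarrow> 1 / 2 * cos (\<nu> * pi)
             * (Digamma ((\<nu> + 1) / 2) - Digamma (\<nu> / 2) - 4 * ln 2 * cos (\<nu> * pi))
           - pi / 2 * sin (2 * \<nu> * pi)
           + cos (2 * \<nu> * pi) * (ln (3 * pi / 2) - Digamma 1 + Digamma \<nu>))"
proof -
  define s c where "s = sin (pi * \<nu>)" and "c = cos (pi * \<nu>)"
  have sc: "s\<^sup>2 = 1 - c\<^sup>2" by (simp add: s_def c_def sin_squared_eq)
  have sin2: "sin (2 * pi * \<nu>) = 2 * s * c" and cos2: "cos (2 * pi * \<nu>) = 2 * c\<^sup>2 - 1"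
    using sin_double[of "pi * \<nu>"] cos_double_cos[of "pi * \<nu>"] by (simp_all add: s_def c_def mult.assoc)
  define S Q where "S = sin_quot_integral (2 * \<nu> - 1)" and "Q = cos_quot_integral (2 * \<nu> - 1)"
  have S: "S = pi / 2 - s * beta_series \<nu>"
    using assms by (simp add: S_def s_def sin_quot_integral_eq)
  have Q: "Q = Digamma \<nu> - Digamma 1 + 2 * ln 2 + c * beta_series \<nu>"
    using assms by (simp add: Q_def c_def cos_quot_integral_eq)
  have ln4: "ln (4::real) = 2 * ln 2" and ln16: "ln (16::real) = 4 * ln 2"
    using ln_realpow[of 2 4] ln_realpow[of 2 2] by simp_all
  note lower = has_integral_sin_integrand_lower[of "2 * \<nu> - 1" "sin (2 * pi * \<nu>)", folded S_def]
  note sin_upper = has_integral_sin_integrand_upper[OF refl refl, of \<nu>, folded S_def Q_def]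
  note cos_upper = has_integral_cos_integrand_upper[OF refl refl, of \<nu>, folded S_def Q_def]

  \<comment> \<open>Integration over the whole of [0, 1], joined at 1/2; the lower endpoint
    contributes \<open>ln (k / k) = 0\<close>. The logarithms of the claim appear with opposite
    sign.\<close>
  have lim1: "(\<lambda>N. \<Sum>k=2..N. (ln ((real k + 1) / (real k - 1)) - ln ((real k + 0) / (real k - 0)))
      * sin (real k * (2 * pi * \<nu>))) \<longlonglongrightarrow> (- S - sin (2 * pi * \<nu>) * ln 3)
        + (- cos (2 * pi * \<nu>) * S - sin (2 * pi * \<nu>) * (Q + ln (pi / 3)))"
    by (rule log_sin_series_tendsto[OF assms _ _ _ has_integral_combine[OF _ _ lower sin_upper]]) auto
  have eq1: "- ((ln ((real k + 1) / (real k - 1)) - ln ((real k + 0) / (real k - 0))) * sin (real k * (2 * pi * \<nu>)))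
      = ln ((real k - 1) / (real k + 1)) * sin (2 * real k * \<nu> * pi)" if "k \<in> {2..N}" for k N
    using that by (simp add: ln_div) (simp add: algebra_simps)
  from tendsto_minus[OF lim1]
  have "(\<lambda>N. \<Sum>k=2..N. ln ((real k - 1) / (real k + 1)) * sin (2 * real k * \<nu> * pi)) \<longlonglongrightarrow>
      - ((- S - sin (2 * pi * \<nu>) * ln 3)
        + (- cos (2 * pi * \<nu>) * S - sin (2 * pi * \<nu>) * (Q + ln (pi / 3))))"
    by (simp only: sum_negf[symmetric] eq1 cong: sum.cong)
  \<comment> \<open>The factor of \<open>S\<close> is
    \<open>1 + cos (2 * pi * \<nu>) = 2 * c\<^sup>2\<close>, so its \<open>beta_series\<close> part
    cancels the one in \<open>sin (2 * pi * \<nu>) * Q\<close>. The logarithms combine as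
    \<open>ln 3 + 2 * ln 2 + ln (pi / 3) = ln (4 * pi)\<close>.\<close>
  moreover have "- ((- S - sin (2 * pi * \<nu>) * ln 3)
        + (- cos (2 * pi * \<nu>) * S - sin (2 * pi * \<nu>) * (Q + ln (pi / 3))))
     = sin (2 * pi * \<nu>) * (ln (4 * pi) - Digamma 1 + Digamma \<nu>) + pi * c\<^sup>2"
    unfolding sin2 cos2 S Q by (simp add: ln_div ln_mult ln4 algebra_simps power2_eq_square)
  ultimately have i: "(\<lambda>N. \<Sum>k=2..N. ln ((real k - 1) / (real k + 1)) * sin (2 * real k * \<nu> * pi))
       \<longlonglongrightarrow> sin (2 * \<nu> * pi) * (ln (4 * pi) - Digamma 1 + Digamma \<nu>) + pi * (cos (\<nu> * pi))\<^sup>2"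
    by (simp add: c_def mult_ac)

  \<comment> \<open>For the second series the range is [0, 1/2], so the lower integral alone
    suffices.\<close>
  have lim2: "(\<lambda>N. \<Sum>k=2..N. (ln ((real k + 1/2) / (real k - 1/2)) - ln ((real k + 0) / (real k - 0)))
      * sin (real k * (2 * pi * \<nu>))) \<longlonglongrightarrow> - S - sin (2 * pi * \<nu>) * ln 3"
    by (rule log_sin_series_tendsto[OF assms _ _ _ lower]) auto
  have eq2: "- ((ln ((real k + 1/2) / (real k - 1/2)) - ln ((real k + 0) / (real k - 0))) * sin (real k * (2 * pi * \<nu>)))
      = ln ((2 * real k - 1) / (2 * real k + 1)) * sin (2 * real k * \<nu> * pi)" if "k \<in> {2..N}" for k N
  proof -
    have "(real k + 1/2) / (real k - 1/2) = (2 * real k + 1) / (2 * real k - 1)"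
      using that by (simp add: field_simps)
    then show ?thesis using that by (simp add: ln_div) (simp add: algebra_simps)
  qed
  from tendsto_minus[OF lim2]
  have "(\<lambda>N. \<Sum>k=2..N. ln ((2 * real k - 1) / (2 * real k + 1)) * sin (2 * real k * \<nu> * pi)) \<longlonglongrightarrow>
      - (- S - sin (2 * pi * \<nu>) * ln 3)"
    by (simp only: sum_negf[symmetric] eq2 cong: sum.cong)
  moreover have "- (- S - sin (2 * pi * \<nu>) * ln 3)
     = 1 / 2 * s * (Digamma (\<nu> / 2) - Digamma ((\<nu> + 1) / 2)) + pi / 2 + ln 3 * sin (2 * pi * \<nu>)"
    by (simp add: S beta_series_def field_simps)
  ultimately have ii: "(\<lambda>N. \<Sum>k=2..N. ln ((2 * real k - 1) / (2 * real k + 1)) * sin (2 * real k * \<nu> * pi))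
       \<longlonglongrightarrow> 1 / 2 * sin (\<nu> * pi) * (Digamma (\<nu> / 2) - Digamma ((\<nu> + 1) / 2))
           + pi / 2 + ln 3 * sin (2 * \<nu> * pi)"
    by (simp add: s_def ac_simps)

  \<comment> \<open>The range [1/2, 1] produces the quotient of \<open>k\<^sup>2 - 1\<close> by
    \<open>k\<^sup>2 - 1/4\<close>, which is the argument of the logarithm in the claim.\<close>
  have lim3: "(\<lambda>N. \<Sum>k=2..N. (- ln ((real k)\<^sup>2 - 1\<^sup>2) - (- ln ((real k)\<^sup>2 - (1/2)\<^sup>2))) * cos (real k * (2 * pi * \<nu>)))
     \<longlonglongrightarrow> ln 2 + sin (2 * pi * \<nu>) * S - cos (2 * pi * \<nu>) * (Q + ln (3 * pi / 16))"
    by (rule log_cos_series_tendsto[OF assms _ _ _ cos_upper]) auto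
  have eq3: "- ((- ln ((real k)\<^sup>2 - 1\<^sup>2) - (- ln ((real k)\<^sup>2 - (1/2)\<^sup>2))) * cos (real k * (2 * pi * \<nu>)))
      = ln (4 * ((real k)\<^sup>2 - 1) / (4 * (real k)\<^sup>2 - 1)) * cos (2 * real k * \<nu> * pi)" if "k \<in> {2..N}" for k N
  proof -
    have "0 < (real k)\<^sup>2 - 1\<^sup>2" "0 < (real k)\<^sup>2 - (1/2)\<^sup>2"
      using that partial_fraction_denominator_pos[of 1 k] partial_fraction_denominator_pos[of "1/2" k]
      by auto
    moreover have "4 * ((real k)\<^sup>2 - 1) / (4 * (real k)\<^sup>2 - 1) = ((real k)\<^sup>2 - 1\<^sup>2) / ((real k)\<^sup>2 - (1/2)\<^sup>2)"
      by (simp add: power2_eq_square field_simps)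
    ultimately have "ln (4 * ((real k)\<^sup>2 - 1) / (4 * (real k)\<^sup>2 - 1)) = ln ((real k)\<^sup>2 - 1\<^sup>2) - ln ((real k)\<^sup>2 - (1/2)\<^sup>2)"
      by (simp only: ln_divide_pos)
    then show ?thesis by (simp only:) (simp add: algebra_simps)
  qed
  from tendsto_minus[OF lim3]
  have "(\<lambda>N. \<Sum>k=2..N. ln (4 * ((real k)\<^sup>2 - 1) / (4 * (real k)\<^sup>2 - 1)) * cos (2 * real k * \<nu> * pi)) \<longlonglongrightarrow>
      - (ln 2 + sin (2 * pi * \<nu>) * S - cos (2 * pi * \<nu>) * (Q + ln (3 * pi / 16)))"
    by (simp only: sum_negf[symmetric] eq3 cong: sum.cong)
  moreover have "- (ln 2 + sin (2 * pi * \<nu>) * S - cos (2 * pi * \<nu>) * (Q + ln (3 * pi / 16)))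
     = 1 / 2 * c * (Digamma ((\<nu> + 1) / 2) - Digamma (\<nu> / 2) - 4 * ln 2 * c) - pi / 2 * sin (2 * pi * \<nu>)
       + cos (2 * pi * \<nu>) * (ln (3 * pi / 2) - Digamma 1 + Digamma \<nu>)"
  proof -
    \<comment> \<open>The addition formula for \<open>cos (2 * pi * \<nu> - pi * \<nu>)\<close>; it
      collapses the two \<open>beta_series\<close> contributions to the single term
      \<open>c * beta_series \<nu>\<close>.\<close>
    have "sin (2 * pi * \<nu>) * s + cos (2 * pi * \<nu>) * c = c"
      using sc unfolding sin2 cos2 by algebra
    moreover have "A * (p - s * b) - B * (d + c * b + l) = A * p - B * (d + l) - c * b"
      if "A * s + B * c = c" for A B p b d l
    proof -
      have "A * (p - s * b) - B * (d + c * b + l) = A * p - B * (d + l) - (A * s + B * c) * b"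
        by (simp add: algebra_simps)
      then show ?thesis by (simp only: that)
    qed
    ultimately have "sin (2 * pi * \<nu>) * S - cos (2 * pi * \<nu>) * (Q + ln (3 * pi / 16))
       = sin (2 * pi * \<nu>) * (pi / 2) - cos (2 * pi * \<nu>) * (Digamma \<nu> - Digamma 1 + 2 * ln 2 + ln (3 * pi / 16))
         - c * beta_series \<nu>"
      unfolding S Q by blast
    then have e1: "ln 2 + sin (2 * pi * \<nu>) * S - cos (2 * pi * \<nu>) * (Q + ln (3 * pi / 16))
       = ln 2 + (sin (2 * pi * \<nu>) * (pi / 2) - cos (2 * pi * \<nu>) * (Digamma \<nu> - Digamma 1 + 2 * ln 2 + ln (3 * pi / 16))
         - c * beta_series \<nu>)"
      by linarith
    have e2: "c * beta_series \<nu> = 1 / 2 * c * (Digamma ((\<nu> + 1) / 2) - Digamma (\<nu> / 2))"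
      by (simp add: beta_series_def)
    have e3: "ln (3 * pi / 16) = ln (3 * pi / 2) - 3 * ln 2"
      by (simp add: ln_div ln_mult ln16)
    \<comment> \<open>The remaining multiples of \<open>ln 2\<close> sum to
      \<open>- (1 + cos (2 * pi * \<nu>)) * ln 2 = - 2 * c\<^sup>2 * ln 2\<close>.\<close>
    show ?thesis
      unfolding e1 unfolding e2 e3 cos2 by (simp add: power2_eq_square algebra_simps)
  qed
  ultimately have iii: "(\<lambda>N. \<Sum>k=2..N. ln (4 * ((real k)\<^sup>2 - 1) / (4 * (real k)\<^sup>2 - 1)) * cos (2 * real k * \<nu> * pi))
       \<longlonglongrightarrow> 1 / 2 * cos (\<nu> * pi)
             * (Digamma ((\<nu> + 1) / 2) - Digamma (\<nu> / 2) - 4 * ln 2 * cos (\<nu> * pi))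
           - pi / 2 * sin (2 * \<nu> * pi)
           + cos (2 * \<nu> * pi) * (ln (3 * pi / 2) - Digamma 1 + Digamma \<nu>)"
    by (simp add: c_def mult_ac)
  from i ii iii show ?thesis by blast
qed

end
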